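(* Let $R$ and $T$ be rings and let ${}_TM_R$ be a $(T,R)$-bimodule. Then the following statements are equivalent. 1) ${}_TM_R$ is separable, that is, the evaluation map $u_M:\ M\otimes_R {}^*M\to T$, $u_M(m\otimes f)=(m)f$, is a split epimorphism of $T$-bimodules. 2) There exists a split epimorphism of $T$-bimodules $\phi:\ M\otimes_R {}^*M\to T$. 3) There exists a split epimorphism of $T$-bimodules $\phi:\ M\otimes_R X\to T$ for some $(R,T)$-bimodule ${}_RX_T$. 4) $T$ is (isomorphic to) a direct summand of $M\otimes_R {}^*M$ as a $T$-bimodule.
   Context: Rings are associative with unit. For a $(T,R)$-bimodule $M$, the left dual is ${}^*M={}_T\mathrm{Hom}(M,T)$, the set of left $T$-linear maps $M\to T$ (written on the right of their argument), which is an $(R,T)$-bimodule via $(m)(rgt)=((mr)g)t$. A split epimorphism of $T$-bimodules is a $T$-bimodule map that has a right inverse which is a $T$-bimodule map. *)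

theory Defs
  imports
    "HOL-Algebra.AbelCoset"
    "HOL-Algebra.Free_Abelian_Groups"
    "HOL-Algebra.Generated_Groups"
    "HOL-Algebra.Module"
begin

section \<open>Bimodules\<close>

text \<open>
  As for the library's type of modules, the multiplication and unit fields that a bimodule
  inherits from the ring record carry no meaning. Rings are not assumed to be commutative or
  nontrivial.
\<close>

record ('l, 'm, 'r) bimodule = "('l, 'm) module" +
  rsmult :: "['m, 'r] \<Rightarrow> 'm" (infixl \<open>\<odot>\<^sub>r\<index>\<close> 70)

locale bimodule = L?: ring L + R?: ring R + M?: abelian_group M
  for L :: "('l, 'c) ring_scheme" and R :: "('r, 'd) ring_scheme"
    and M :: "('l, 'm, 'r, 'e) bimodule_scheme" (structure) +
  assumes lsmult_closed [simp, intro]: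
      "\<lbrakk>a \<in> carrier L; x \<in> carrier M\<rbrakk> \<Longrightarrow> a \<odot> x \<in> carrier M"
    and rsmult_closed [simp, intro]:
      "\<lbrakk>x \<in> carrier M; r \<in> carrier R\<rbrakk> \<Longrightarrow> x \<odot>\<^sub>r r \<in> carrier M"
    and lsmult_l_distr:
      "\<lbrakk>a \<in> carrier L; b \<in> carrier L; x \<in> carrier M\<rbrakk> \<Longrightarrow> (a \<oplus>\<^bsub>L\<^esub> b) \<odot> x = a \<odot> x \<oplus> b \<odot> x"
    and lsmult_r_distr:
      "\<lbrakk>a \<in> carrier L; x \<in> carrier M; y \<in> carrier M\<rbrakk> \<Longrightarrow> a \<odot> (x \<oplus> y) = a \<odot> x \<oplus> a \<odot> y"
    and lsmult_assoc:
      "\<lbrakk>a \<in> carrier L; b \<in> carrier L; x \<in> carrier M\<rbrakk> \<Longrightarrow> (a \<otimes>\<^bsub>L\<^esub> b) \<odot> x = a \<odot> (b \<odot> x)"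
    and lsmult_one:
      "x \<in> carrier M \<Longrightarrow> \<one>\<^bsub>L\<^esub> \<odot> x = x"
    and rsmult_l_distr:
      "\<lbrakk>x \<in> carrier M; y \<in> carrier M; r \<in> carrier R\<rbrakk> \<Longrightarrow> (x \<oplus> y) \<odot>\<^sub>r r = x \<odot>\<^sub>r r \<oplus> y \<odot>\<^sub>r r"
    and rsmult_r_distr:
      "\<lbrakk>x \<in> carrier M; r \<in> carrier R; s \<in> carrier R\<rbrakk> \<Longrightarrow> x \<odot>\<^sub>r (r \<oplus>\<^bsub>R\<^esub> s) = x \<odot>\<^sub>r r \<oplus> x \<odot>\<^sub>r s"
    and rsmult_assoc:
      "\<lbrakk>x \<in> carrier M; r \<in> carrier R; s \<in> carrier R\<rbrakk> \<Longrightarrow> x \<odot>\<^sub>r (r \<otimes>\<^bsub>R\<^esub> s) = (x \<odot>\<^sub>r r) \<odot>\<^sub>r s"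
    and rsmult_one:
      "x \<in> carrier M \<Longrightarrow> x \<odot>\<^sub>r \<one>\<^bsub>R\<^esub> = x"
    and smult_commute:
      "\<lbrakk>a \<in> carrier L; x \<in> carrier M; r \<in> carrier R\<rbrakk> \<Longrightarrow> (a \<odot> x) \<odot>\<^sub>r r = a \<odot> (x \<odot>\<^sub>r r)"

definition bimodule_hom ::
  "('l, 'c) ring_scheme \<Rightarrow> ('r, 'd) ring_scheme \<Rightarrow> ('l, 'm, 'r, 'e) bimodule_scheme \<Rightarrow>
    ('l, 'n, 'r, 'f) bimodule_scheme \<Rightarrow> ('m \<Rightarrow> 'n) set"
  where "bimodule_hom L R M N = {f \<in> carrier M \<rightarrow> carrier N.
    (\<forall>x\<in>carrier M. \<forall>y\<in>carrier M. f (x \<oplus>\<^bsub>M\<^esub> y) = f x \<oplus>\<^bsub>N\<^esub> f y) \<and>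
    (\<forall>a\<in>carrier L. \<forall>x\<in>carrier M. f (a \<odot>\<^bsub>M\<^esub> x) = a \<odot>\<^bsub>N\<^esub> f x) \<and>
    (\<forall>x\<in>carrier M. \<forall>r\<in>carrier R. f (x \<odot>\<^sub>r\<^bsub>M\<^esub> r) = f x \<odot>\<^sub>r\<^bsub>N\<^esub> r)}"

definition split_epi ::
  "('l, 'c) ring_scheme \<Rightarrow> ('r, 'd) ring_scheme \<Rightarrow> ('l, 'm, 'r, 'e) bimodule_scheme \<Rightarrow>
    ('l, 'n, 'r, 'f) bimodule_scheme \<Rightarrow> ('m \<Rightarrow> 'n) \<Rightarrow> bool"
  where "split_epi L R M N f \<longleftrightarrow> f \<in> bimodule_hom L R M N \<and>
    (\<exists>g \<in> bimodule_hom L R N M. \<forall>y\<in>carrier N. f (g y) = y)"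

definition bimodule_iso ::
  "('l, 'c) ring_scheme \<Rightarrow> ('r, 'd) ring_scheme \<Rightarrow> ('l, 'm, 'r, 'e) bimodule_scheme \<Rightarrow>
    ('l, 'n, 'r, 'f) bimodule_scheme \<Rightarrow> bool"
  where "bimodule_iso L R M N \<longleftrightarrow>
    (\<exists>f \<in> bimodule_hom L R M N. bij_betw f (carrier M) (carrier N))"

definition subbimodule ::
  "('l, 'c) ring_scheme \<Rightarrow> ('r, 'd) ring_scheme \<Rightarrow> 'm set \<Rightarrow>
    ('l, 'm, 'r, 'e) bimodule_scheme \<Rightarrow> bool"
  where "subbimodule L R A M \<longleftrightarrow> subgroup A (add_monoid M) \<and>
    (\<forall>a\<in>carrier L. \<forall>x\<in>A. a \<odot>\<^bsub>M\<^esub> x \<in> A) \<and> (\<forall>x\<in>A. \<forall>r\<in>carrier R. x \<odot>\<^sub>r\<^bsub>M\<^esub> r \<in> A)"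

definition direct_summand ::
  "('l, 'c) ring_scheme \<Rightarrow> ('r, 'd) ring_scheme \<Rightarrow> 'm set \<Rightarrow>
    ('l, 'm, 'r, 'e) bimodule_scheme \<Rightarrow> bool"
  where "direct_summand L R A M \<longleftrightarrow> subbimodule L R A M \<and>
    (\<exists>B. subbimodule L R B M \<and> A <+>\<^bsub>M\<^esub> B = carrier M \<and> A \<inter> B = {\<zero>\<^bsub>M\<^esub>})"

definition regular_bimodule :: "('t, 'c) ring_scheme \<Rightarrow> ('t, 't, 't) bimodule"
  where "regular_bimodule T = \<lparr>carrier = carrier T, monoid.mult = monoid.mult T, one = \<one>\<^bsub>T\<^esub>,
    ring.zero = \<zero>\<^bsub>T\<^esub>, add = add T, smult = monoid.mult T, rsmult = monoid.mult T\<rparr>"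

text \<open>
  The left dual \<open>\<^sup>*M\<close> of a \<open>(T,R)\<close>-bimodule \<open>M\<close>, with maps written on the left of their
  argument. The \<open>(R,T)\<close>-bimodule structure is thus \<open>(r g t)(m) = g(m r) t\<close>.
\<close>

definition left_dual ::
  "('t, 'c) ring_scheme \<Rightarrow> ('t, 'm, 'r, 'e) bimodule_scheme \<Rightarrow> ('r, 'm \<Rightarrow> 't, 't) bimodule"
  where "left_dual T M = \<lparr>
    carrier = {f \<in> carrier M \<rightarrow>\<^sub>E carrier T.
      (\<forall>x\<in>carrier M. \<forall>y\<in>carrier M. f (x \<oplus>\<^bsub>M\<^esub> y) = f x \<oplus>\<^bsub>T\<^esub> f y) \<and>
      (\<forall>t\<in>carrier T. \<forall>x\<in>carrier M. f (t \<odot>\<^bsub>M\<^esub> x) = t \<otimes>\<^bsub>T\<^esub> f x)},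
    monoid.mult = undefined, one = undefined,
    ring.zero = (\<lambda>m\<in>carrier M. \<zero>\<^bsub>T\<^esub>),
    add = (\<lambda>f g. \<lambda>m\<in>carrier M. f m \<oplus>\<^bsub>T\<^esub> g m),
    smult = (\<lambda>r f. \<lambda>m\<in>carrier M. f (m \<odot>\<^sub>r\<^bsub>M\<^esub> r)),
    rsmult = (\<lambda>f t. \<lambda>m\<in>carrier M. f m \<otimes>\<^bsub>T\<^esub> t)\<rparr>"


section \<open>Tensor products over a ring that need not be commutative\<close>

text \<open>
  \<open>M \<otimes>\<^sub>R N\<close> is the free abelian group on the pairs \<open>(m, n)\<close> modulo the subgroup generated by the
  biadditivity and \<open>R\<close>-balancedness relations. Its elements are cosets.
\<close>

abbreviation tensor_free ::
  "('l, 'm, 'r, 'e) bimodule_scheme \<Rightarrow> ('r, 'n, 's, 'f) bimodule_scheme \<Rightarrow> ('m \<times> 'n \<Rightarrow>\<^sub>0 int) monoid"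
  where "tensor_free M N \<equiv> free_Abelian_group (carrier M \<times> carrier N)"

definition tensor_relators ::
  "('l, 'm, 'r, 'e) bimodule_scheme \<Rightarrow> ('r, 'd) ring_scheme \<Rightarrow> ('r, 'n, 's, 'f) bimodule_scheme \<Rightarrow>
    ('m \<times> 'n \<Rightarrow>\<^sub>0 int) set"
  where "tensor_relators M R N =
    {frag_of (m \<oplus>\<^bsub>M\<^esub> m', n) - frag_of (m, n) - frag_of (m', n) | m m' n.
       m \<in> carrier M \<and> m' \<in> carrier M \<and> n \<in> carrier N} \<union>
    {frag_of (m, n \<oplus>\<^bsub>N\<^esub> n') - frag_of (m, n) - frag_of (m, n') | m n n'.
       m \<in> carrier M \<and> n \<in> carrier N \<and> n' \<in> carrier N} \<union>
    {frag_of (m \<odot>\<^sub>r\<^bsub>M\<^esub> r, n) - frag_of (m, r \<odot>\<^bsub>N\<^esub> n) | m r n.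
       m \<in> carrier M \<and> r \<in> carrier R \<and> n \<in> carrier N}"

definition tensor_kernel ::
  "('l, 'm, 'r, 'e) bimodule_scheme \<Rightarrow> ('r, 'd) ring_scheme \<Rightarrow> ('r, 'n, 's, 'f) bimodule_scheme \<Rightarrow>
    ('m \<times> 'n \<Rightarrow>\<^sub>0 int) set"
  where "tensor_kernel M R N = generate (tensor_free M N) (tensor_relators M R N)"

text \<open>
  The actions \<open>l (m \<otimes> n) = (l m) \<otimes> n\<close> and \<open>(m \<otimes> n) s = m \<otimes> (n s)\<close> are extended linearly to the
  free group; a coset \<open>C\<close> is sent to the coset containing the image of \<open>C\<close>.
\<close>

definition tensor ::
  "('l, 'm, 'r, 'e) bimodule_scheme \<Rightarrow> ('r, 'd) ring_scheme \<Rightarrow> ('r, 'n, 's, 'f) bimodule_scheme \<Rightarrow>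
    ('l, ('m \<times> 'n \<Rightarrow>\<^sub>0 int) set, 's) bimodule"
  where "tensor M R N =
    (let F = tensor_free M N; K = tensor_kernel M R N in
      \<lparr>carrier = carrier (F Mod K), monoid.mult = undefined, one = undefined,
       ring.zero = \<one>\<^bsub>F Mod K\<^esub>, add = monoid.mult (F Mod K),
       smult = (\<lambda>l C. K <#>\<^bsub>F\<^esub> (frag_extend (\<lambda>(m, n). frag_of (l \<odot>\<^bsub>M\<^esub> m, n)) ` C)),
       rsmult = (\<lambda>C s. K <#>\<^bsub>F\<^esub> (frag_extend (\<lambda>(m, n). frag_of (m, n \<odot>\<^sub>r\<^bsub>N\<^esub> s)) ` C))\<rparr>)"

definition tensor_elem ::
  "('l, 'm, 'r, 'e) bimodule_scheme \<Rightarrow> ('r, 'd) ring_scheme \<Rightarrow> ('r, 'n, 's, 'f) bimodule_scheme \<Rightarrow>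
    'm \<Rightarrow> 'n \<Rightarrow> ('m \<times> 'n \<Rightarrow>\<^sub>0 int) set"
  where "tensor_elem M R N m n = tensor_kernel M R N #>\<^bsub>tensor_free M N\<^esub> frag_of (m, n)"

text \<open>
  The map \<open>m \<otimes> n \<mapsto> b m n\<close> from \<open>M \<otimes>\<^sub>R N\<close> to an abelian group \<open>A\<close>. If \<open>b\<close> is biadditive and
  balanced, then the \<open>\<int>\<close>-linear extension of \<open>b\<close> is constant on each coset, and its value there
  is selected by \<open>the_elem\<close>.
\<close>

definition frag_eval :: "('a, 'c) ring_scheme \<Rightarrow> ('p \<Rightarrow> 'a) \<Rightarrow> ('p \<Rightarrow>\<^sub>0 int) \<Rightarrow> 'a"
  where "frag_eval A b c =
    (\<Oplus>\<^bsub>A\<^esub>p\<in>Poly_Mapping.keys c. add_pow A (Poly_Mapping.lookup c p) (b p))"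

definition tensor_lift ::
  "('a, 'c) ring_scheme \<Rightarrow> ('m \<Rightarrow> 'n \<Rightarrow> 'a) \<Rightarrow> ('m \<times> 'n \<Rightarrow>\<^sub>0 int) set \<Rightarrow> 'a"
  where "tensor_lift A b C = the_elem (frag_eval A (\<lambda>(m, n). b m n) ` C)"

definition evaluation_map ::
  "('t, 'c) ring_scheme \<Rightarrow> ('m \<times> ('m \<Rightarrow> 't) \<Rightarrow>\<^sub>0 int) set \<Rightarrow> 't"
  where "evaluation_map T = tensor_lift T (\<lambda>m f. f m)"

definition separable_bimodule ::
  "('t, 'c) ring_scheme \<Rightarrow> ('r, 'd) ring_scheme \<Rightarrow> ('t, 'm, 'r, 'e) bimodule_scheme \<Rightarrow> bool"
  where "separable_bimodule T R M \<longleftrightarrow>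
    split_epi T T (tensor M R (left_dual T M)) (regular_bimodule T) (evaluation_map T)"

end

theory Submission
  imports Defs
begin

text \<open>
  Everything reduces to the following: if a \<open>T\<close>-bimodule map \<open>\<phi> : M \<otimes>\<^sub>R X \<rightarrow> T\<close> has a section
  \<open>g\<close>, then so does the evaluation map. Each \<open>x\<close> in \<open>X\<close> yields the functional
  \<open>d x = (m \<mapsto> \<phi> (m \<otimes> x))\<close> on \<open>M\<close>, and \<open>d : X \<rightarrow> \<^sup>*M\<close> is a map of \<open>(R,T)\<close>-bimodules. Since
  \<open>u\<^sub>M (m \<otimes> d x) = \<phi> (m \<otimes> x)\<close>, the map \<open>\<phi>\<close> factors as \<open>u\<^sub>M \<circ> (M \<otimes> d)\<close>, and \<open>(M \<otimes> d) \<circ> g\<close> is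
  a section of \<open>u\<^sub>M\<close>. That split epimorphisms onto \<open>T\<close> correspond to direct summands isomorphic
  to \<open>T\<close> holds for bimodules in general.
\<close>

section \<open>Evaluation on free abelian groups\<close>

text \<open>The preimage of \<open>J\<close> under \<open>h\<close> is a subgroup containing
  \<open>S\<close>. With \<open>J\<close> the relation subgroup this lets the two actions descend to
  the tensor product; with \<open>J\<close> trivial it makes \<open>tensor_lift\<close> well
  defined.\<close>

lemma generate_hom_mem_subgroup:
  assumes "group_hom G H h" and "subgroup J H" and "S \<subseteq> carrier G"
    and "\<And>x. x \<in> S \<Longrightarrow> h x \<in> J" and "x \<in> generate G S"
  shows "h x \<in> J"
proof -
  interpret group_hom G H h by fact
  have in_carrier: "y \<in> carrier G" if "y \<in> generate G S" for y
    using G.generate_in_carrier[OF assms(3)] that .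
  show ?thesis
    using assms(5)
  proof (induction rule: generate.induct)
    case one
    then show ?case using assms(2) by (simp add: subgroup.one_closed)
  next
    case (incl y)
    then show ?case by (rule assms(4))
  next
    case (inv y)
    then show ?case using assms by (auto simp: subgroup.m_inv_closed)
  next
    case (eng y z)
    then show ?case using assms(2) by (simp add: in_carrier subgroup.m_closed)
  qed
qed

context abelian_group
begin

lemma int_add_pow:
  fixes j k :: int
  assumes "x \<in> carrier G"
  shows "[k] \<cdot> x \<in> carrier G" and "[(0 :: int)] \<cdot> x = \<zero>" and "[(1 :: int)] \<cdot> x = x"
    and "[(j + k)] \<cdot> x = [j] \<cdot> x \<oplus> [k] \<cdot> x"
  using group.int_pow_closed[OF a_group, of x k] group.int_pow_mult[OF a_group, of x j k]
    group.int_pow_1[OF a_group, of x] assms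
  by (simp_all add: add_pow_def int_pow_def2)

text \<open>Points outside the support have coefficient 0 and contribute zero. Several chains can
  thus be summed over one common index set.\<close>

lemma frag_eval_superset:
  assumes "b \<in> S \<rightarrow> carrier G" and "finite I" and "I \<subseteq> S" and "Poly_Mapping.keys c \<subseteq> I"
  shows "frag_eval G b c = (\<Oplus>p\<in>I. [Poly_Mapping.lookup c p] \<cdot> b p)"
  unfolding frag_eval_def
  by (rule add.finprod_mono_neutral_cong_left) (use assms in \<open>auto simp: in_keys_iff int_add_pow Pi_iff subset_iff\<close>)

lemma frag_eval_closed:
  assumes "b \<in> S \<rightarrow> carrier G" and "Poly_Mapping.keys c \<subseteq> S"
  shows "frag_eval G b c \<in> carrier G"
  unfolding frag_eval_def using assms by (intro add.finprod_closed) (auto simp: int_add_pow Pi_iff subset_iff)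

lemma frag_eval_add:
  assumes b: "b \<in> S \<rightarrow> carrier G" and "Poly_Mapping.keys c \<subseteq> S" and "Poly_Mapping.keys d \<subseteq> S"
  shows "frag_eval G b (c + d) = frag_eval G b c \<oplus> frag_eval G b d"
proof -
  \<comment> \<open>Cancellation can make the support of \<open>c + d\<close> smaller than the union
    of the supports, so all three sums are taken over the union.\<close>
  let ?I = "Poly_Mapping.keys c \<union> Poly_Mapping.keys d"
  have I: "finite ?I" "?I \<subseteq> S" "Poly_Mapping.keys (c + d) \<subseteq> ?I"
    using assms keys_add[of c d] by auto
  have "frag_eval G b (c + d) =
      (\<Oplus>p\<in>?I. [Poly_Mapping.lookup c p] \<cdot> b p \<oplus> [Poly_Mapping.lookup d p] \<cdot> b p)"
    unfolding frag_eval_superset[OF b I]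
    using I b by (intro add.finprod_cong') (auto simp: Poly_Mapping.lookup_add int_add_pow Pi_iff subset_iff)
  also have "\<dots> = frag_eval G b c \<oplus> frag_eval G b d"
    using I b frag_eval_superset[OF b I(1,2), of c] frag_eval_superset[OF b I(1,2), of d]
    by (subst add.finprod_multf) (auto simp: int_add_pow Pi_iff subset_iff)
  finally show ?thesis .
qed

lemma frag_eval_hom:
  assumes "b \<in> S \<rightarrow> carrier G"
  shows "group_hom (free_Abelian_group S) (add_monoid G) (frag_eval G b)"
  using assms
  by (auto simp: group_hom_def group_hom_axioms_def hom_def frag_eval_closed frag_eval_add a_group)

lemma frag_eval_of:
  assumes "b p \<in> carrier G"
  shows "frag_eval G b (frag_of p) = b p"
  using assms frag_eval_superset[of b "{p}" "{p}" "frag_of p"] by (simp add: int_add_pow)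

end

lemma frag_extend_hom:
  assumes "\<And>p. p \<in> S \<Longrightarrow> Poly_Mapping.keys (f p) \<subseteq> S'"
  shows "group_hom (free_Abelian_group S) (free_Abelian_group S') (frag_extend f)"
proof -
  have "Poly_Mapping.keys (frag_extend f c) \<subseteq> S'" if "Poly_Mapping.keys c \<subseteq> S" for c
    using keys_frag_extend[of f c] assms that by fast
  then show ?thesis
    by (auto simp: group_hom_def group_hom_axioms_def hom_def frag_extend_add)
qed


section \<open>The tensor product as a bimodule\<close>

locale tensor_product = M: bimodule L R M + N: bimodule R S N
  for L :: "('l, 'c) ring_scheme" and R :: "('r, 'd) ring_scheme"
    and S :: "('s, 'g) ring_scheme" and M :: "('l, 'm, 'r, 'e) bimodule_scheme"
    and N :: "('r, 'n, 's, 'f) bimodule_scheme"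
begin

abbreviation "F \<equiv> tensor_free M N"
abbreviation "K \<equiv> tensor_kernel M R N"
abbreviation "W \<equiv> tensor M R N"
abbreviation "tn \<equiv> tensor_elem M R N"
abbreviation "keys_in c \<equiv> Poly_Mapping.keys c \<subseteq> carrier M \<times> carrier N"

text \<open>The coset of an arbitrary chain, whereas \<open>tn\<close> gives only cosets of single
  generators. Operations on \<open>W\<close> are computed on such representatives.\<close>

definition cls :: "('m \<times> 'n \<Rightarrow>\<^sub>0 int) \<Rightarrow> ('m \<times> 'n \<Rightarrow>\<^sub>0 int) set"
  where "cls c = K #>\<^bsub>F\<^esub> c"

sublocale F: comm_group F
  by (rule abelian_free_Abelian_group)

section \<open>Cosets of the relation subgroup and their addition\<close>

lemma keys_in_diff: "keys_in a \<Longrightarrow> keys_in b \<Longrightarrow> keys_in (a - b)"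
  using keys_diff[of a b] by fast

lemma keys_in_add: "keys_in a \<Longrightarrow> keys_in b \<Longrightarrow> keys_in (a + b)"
  using keys_add[of a b] by fast

lemma relatorsI:
  "\<lbrakk>m \<in> carrier M; m' \<in> carrier M; n \<in> carrier N\<rbrakk> \<Longrightarrow>
    frag_of (m \<oplus>\<^bsub>M\<^esub> m', n) - frag_of (m, n) - frag_of (m', n) \<in> tensor_relators M R N"
  "\<lbrakk>m \<in> carrier M; n \<in> carrier N; n' \<in> carrier N\<rbrakk> \<Longrightarrow>
    frag_of (m, n \<oplus>\<^bsub>N\<^esub> n') - frag_of (m, n) - frag_of (m, n') \<in> tensor_relators M R N"
  "\<lbrakk>m \<in> carrier M; r \<in> carrier R; n \<in> carrier N\<rbrakk> \<Longrightarrow>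
    frag_of (m \<odot>\<^sub>r\<^bsub>M\<^esub> r, n) - frag_of (m, r \<odot>\<^bsub>N\<^esub> n) \<in> tensor_relators M R N"
  unfolding tensor_relators_def by blast+

lemma relators_cases [consumes 1, case_names add_left add_right balanced]:
  assumes "x \<in> tensor_relators M R N"
  obtains m m' n where "m \<in> carrier M" "m' \<in> carrier M" "n \<in> carrier N"
      "x = frag_of (m \<oplus>\<^bsub>M\<^esub> m', n) - frag_of (m, n) - frag_of (m', n)"
  | m n n' where "m \<in> carrier M" "n \<in> carrier N" "n' \<in> carrier N"
      "x = frag_of (m, n \<oplus>\<^bsub>N\<^esub> n') - frag_of (m, n) - frag_of (m, n')"
  | m r n where "m \<in> carrier M" "r \<in> carrier R" "n \<in> carrier N"
      "x = frag_of (m \<odot>\<^sub>r\<^bsub>M\<^esub> r, n) - frag_of (m, r \<odot>\<^bsub>N\<^esub> n)"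
  using assms unfolding tensor_relators_def
proof (elim UnE CollectE exE conjE, goal_cases)
  case (1 m m' n)
  then show ?case by (intro that(1)[of m m' n])
next
  case (2 m n n')
  then show ?case by (intro that(2)[of m n n'])
next
  case (3 m r n)
  then show ?case by (intro that(3)[of m r n])
qed

lemma relators_subset: "tensor_relators M R N \<subseteq> carrier F"
  unfolding tensor_relators_def
  by (auto dest!: subsetD[OF keys_diff])

lemma kernel_subgroup: "subgroup K F"
  unfolding tensor_kernel_def by (rule F.generate_is_subgroup[OF relators_subset])

sublocale K: normal K F
  by (rule F.subgroup_imp_normal[OF kernel_subgroup])

lemma relator_mem_kernel: "x \<in> tensor_relators M R N \<Longrightarrow> x \<in> K"
  unfolding tensor_kernel_def by (rule generate.incl)

lemma mem_cls_iff: "y \<in> cls c \<longleftrightarrow> (\<exists>k\<in>K. y = k + c)"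
  by (simp add: cls_def r_coset_def)

lemma mem_cls_self: "keys_in c \<Longrightarrow> c \<in> cls c"
  unfolding cls_def using F.rcos_self[OF _ kernel_subgroup] by simp

lemma set_mult_kernel_iff: "y \<in> K <#>\<^bsub>F\<^esub> C \<longleftrightarrow> (\<exists>k\<in>K. \<exists>x\<in>C. y = k + x)"
  by (simp add: set_mult_def)

text \<open>Together with \<open>relator_mem_kernel\<close> this turns every relator into an
  identity between pure tensors.\<close>

lemma cls_eq_iff:
  assumes "keys_in a" and "keys_in b"
  shows "cls a = cls b \<longleftrightarrow> a - b \<in> K"
proof
  assume "cls a = cls b"
  with mem_cls_self[OF assms(1)] obtain k where "k \<in> K" "a = k + b"
    by (auto simp: mem_cls_iff)
  then show "a - b \<in> K" by simp
next
  assume "a - b \<in> K"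
  then have "a \<in> K #>\<^bsub>F\<^esub> b"
    by (auto simp: r_coset_def intro!: bexI[of _ "a - b"])
  then show "cls a = cls b"
    unfolding cls_def using F.repr_independence[OF _ _ kernel_subgroup] assms by simp
qed

lemma carrier_tensor: "carrier W = cls ` {c. keys_in c}"
  by (auto simp: tensor_def Let_def FactGroup_def RCOSETS_def cls_def)

lemma tensor_cases:
  assumes "C \<in> carrier W"
  obtains c where "C = cls c" "keys_in c"
  using assms by (auto simp: carrier_tensor)

lemma cls_closed [simp, intro]: "keys_in c \<Longrightarrow> cls c \<in> carrier W"
  by (auto simp: carrier_tensor)

lemma tensor_elem_conv: "tn m n = cls (frag_of (m, n))"
  by (simp add: tensor_elem_def cls_def)

lemma tensor_elem_closed [simp, intro]:
  "m \<in> carrier M \<Longrightarrow> n \<in> carrier N \<Longrightarrow> tn m n \<in> carrier W"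
  by (auto simp: tensor_elem_conv)

lemma add_cls: "keys_in a \<Longrightarrow> keys_in b \<Longrightarrow> cls a \<oplus>\<^bsub>W\<^esub> cls b = cls (a + b)"
  by (simp add: tensor_def Let_def FactGroup_def cls_def K.rcos_sum)

text \<open>The identity of the quotient group is the subgroup \<open>K\<close> itself, and
  translating \<open>K\<close> by its own element 0 leaves it unchanged.\<close>

lemma zero_cls: "\<zero>\<^bsub>W\<^esub> = cls 0"
  using F.coset_join2[OF F.one_closed kernel_subgroup K.one_closed]
  by (simp add: tensor_def Let_def FactGroup_def cls_def)

lemma abelian_group_tensor: "abelian_group W"
proof (rule abelian_groupI)
  fix x y z assume "x \<in> carrier W" "y \<in> carrier W" "z \<in> carrier W"
  then obtain a b c where "x = cls a" "y = cls b" "z = cls c" "keys_in a" "keys_in b" "keys_in c"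
    by (auto simp: carrier_tensor)
  then show "x \<oplus>\<^bsub>W\<^esub> y \<oplus>\<^bsub>W\<^esub> z = x \<oplus>\<^bsub>W\<^esub> (y \<oplus>\<^bsub>W\<^esub> z)"
    by (simp add: add_cls keys_in_add add.assoc)
next
  fix x assume "x \<in> carrier W"
  then obtain c where "x = cls c" "keys_in c" by (auto simp: carrier_tensor)
  then show "\<exists>y\<in>carrier W. y \<oplus>\<^bsub>W\<^esub> x = \<zero>\<^bsub>W\<^esub>"
    by (intro bexI[of _ "cls (- c)"]) (auto simp: add_cls zero_cls)
qed (auto simp: carrier_tensor add_cls zero_cls add.commute keys_in_add)

sublocale W: abelian_group W
  by (rule abelian_group_tensor)

lemma minus_cls: "keys_in a \<Longrightarrow> keys_in b \<Longrightarrow> cls a \<ominus>\<^bsub>W\<^esub> cls b = cls (a - b)"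
proof -
  assume a: "keys_in a" and b: "keys_in b"
  have "cls a = cls (a - b) \<oplus>\<^bsub>W\<^esub> cls b"
    using a b by (simp add: add_cls keys_in_diff)
  moreover have "cls (a - b) \<in> carrier W" using a b by (intro cls_closed keys_in_diff)
  ultimately show ?thesis
    using b by (simp add: a_minus_def W.add.m_assoc W.r_neg)
qed

text \<open>Pure tensors generate \<open>W\<close> as an abelian group. A single case for
  differences covers both sums and negatives, in the pattern of
  \<open>free_Abelian_group_induct\<close>.\<close>

lemma tensor_induct [consumes 1, case_names zero elem diff]:
  assumes "C \<in> carrier W" and "P \<zero>\<^bsub>W\<^esub>"
    and "\<And>m n. m \<in> carrier M \<Longrightarrow> n \<in> carrier N \<Longrightarrow> P (tn m n)"
    and "\<And>C D. C \<in> carrier W \<Longrightarrow> D \<in> carrier W \<Longrightarrow> P C \<Longrightarrow> P D \<Longrightarrow> P (C \<ominus>\<^bsub>W\<^esub> D)"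
  shows "P C"
proof -
  obtain c where c: "C = cls c" "keys_in c" using assms(1) by (auto simp: carrier_tensor)
  have "P (cls c)"
    using c(2)
  proof (rule free_Abelian_group_induct)
    show "P (cls 0)" using assms(2) by (simp add: zero_cls)
    show "P (cls (x - y))" if "keys_in x" "keys_in y" "P (cls x)" "P (cls y)" for x y
      using assms(4)[of "cls x" "cls y"] that by (simp add: minus_cls)
    show "P (cls (frag_of p))" if "p \<in> carrier M \<times> carrier N" for p
      using that assms(3) by (cases p) (auto simp: tensor_elem_conv)
  qed
  with c show ?thesis by simp
qed

section \<open>Biadditivity and balancedness of pure tensors\<close>

lemma tensor_elem_add_left:
  assumes "m \<in> carrier M" "m' \<in> carrier M" "n \<in> carrier N"
  shows "tn (m \<oplus>\<^bsub>M\<^esub> m') n = tn m n \<oplus>\<^bsub>W\<^esub> tn m' n"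
proof -
  have "frag_of (m \<oplus>\<^bsub>M\<^esub> m', n) - frag_of (m, n) - frag_of (m', n) \<in> K"
    using assms by (intro relator_mem_kernel relatorsI)
  then show ?thesis
    using assms by (simp add: tensor_elem_conv add_cls cls_eq_iff keys_in_add diff_diff_eq)
qed

lemma tensor_elem_add_right:
  assumes "m \<in> carrier M" "n \<in> carrier N" "n' \<in> carrier N"
  shows "tn m (n \<oplus>\<^bsub>N\<^esub> n') = tn m n \<oplus>\<^bsub>W\<^esub> tn m n'"
proof -
  have "frag_of (m, n \<oplus>\<^bsub>N\<^esub> n') - frag_of (m, n) - frag_of (m, n') \<in> K"
    using assms by (intro relator_mem_kernel relatorsI)
  then show ?thesis
    using assms by (simp add: tensor_elem_conv add_cls cls_eq_iff keys_in_add diff_diff_eq)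
qed

lemma tensor_elem_balanced:
  assumes "m \<in> carrier M" "r \<in> carrier R" "n \<in> carrier N"
  shows "tn (m \<odot>\<^sub>r\<^bsub>M\<^esub> r) n = tn m (r \<odot>\<^bsub>N\<^esub> n)"
proof -
  have "frag_of (m \<odot>\<^sub>r\<^bsub>M\<^esub> r, n) - frag_of (m, r \<odot>\<^bsub>N\<^esub> n) \<in> K"
    using assms by (intro relator_mem_kernel relatorsI)
  then show ?thesis
    using assms by (simp add: tensor_elem_conv cls_eq_iff)
qed

section \<open>The left and right actions on cosets\<close>

text \<open>Both actions on the tensor product are instances: each comes from an endomorphism of the
  free group that preserves the relators.\<close>

lemma induced_action:
  assumes closed: "\<And>m n. m \<in> carrier M \<Longrightarrow> n \<in> carrier N \<Longrightarrow> f m n \<in> carrier M \<times> carrier N"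
    and relators: "\<And>x. x \<in> tensor_relators M R N \<Longrightarrow>
      frag_extend (\<lambda>(m, n). frag_of (f m n)) x \<in> K"
    and c: "keys_in c"
  shows "K <#>\<^bsub>F\<^esub> (frag_extend (\<lambda>(m, n). frag_of (f m n)) ` cls c) =
      cls (frag_extend (\<lambda>(m, n). frag_of (f m n)) c)"
    and "keys_in (frag_extend (\<lambda>(m, n). frag_of (f m n)) c)"
proof -
  let ?h = "frag_extend (\<lambda>(m, n). frag_of (f m n))"
  have "keys_in (case p of (m, n) \<Rightarrow> frag_of (f m n))" if "p \<in> carrier M \<times> carrier N" for p
    using closed[of "fst p" "snd p"] that by (simp add: case_prod_beta mem_Times_iff)
  then have hom: "group_hom F F ?h"
    by (rule frag_extend_hom)
  \<comment> \<open>It is enough to know this on the relators, since they generate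
    \<open>K\<close>.\<close>
  have hK: "?h k \<in> K" if "k \<in> K" for k
    using generate_hom_mem_subgroup[OF hom kernel_subgroup relators_subset relators] that
    by (simp add: tensor_kernel_def)
  show "K <#>\<^bsub>F\<^esub> (?h ` cls c) = cls (?h c)"
  proof (intro subset_antisym subsetI)
    fix y assume "y \<in> K <#>\<^bsub>F\<^esub> (?h ` cls c)"
    then obtain k k' where k: "k \<in> K" "k' \<in> K" and y: "y = k + ?h (k' + c)"
      unfolding set_mult_kernel_iff image_iff Bex_def mem_cls_iff by blast
    \<comment> \<open>The image of \<open>k' + c\<close> splits as \<open>?h k' + ?h c\<close>, and
      its first summand is absorbed by \<open>K\<close>. Hence the coset obtained does not depend on
      the representative.\<close>
    have "k + ?h k' \<in> K" using K.m_closed[OF k(1) hK[OF k(2)]] by simp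
    moreover have "y = (k + ?h k') + ?h c"
      unfolding y frag_extend_add by (rule add.assoc[symmetric])
    ultimately show "y \<in> cls (?h c)" unfolding mem_cls_iff by (intro bexI)
  next
    fix y assume "y \<in> cls (?h c)"
    then obtain k where "k \<in> K" "y = k + ?h c" unfolding mem_cls_iff by (elim bexE)
    moreover have "?h c \<in> ?h ` cls c" by (rule imageI[OF mem_cls_self[OF c]])
    ultimately show "y \<in> K <#>\<^bsub>F\<^esub> (?h ` cls c)"
      unfolding set_mult_kernel_iff by (intro bexI)
  qed
  show "keys_in (?h c)"
    using group_hom.hom_closed[OF hom, of c] c by simp
qed

text \<open>Each of the three families of relators is mapped into itself. The first uses additivity
  of the action of \<open>l\<close> on \<open>M\<close>; the balancing relators use that the two
  actions on \<open>M\<close> commute. The right action is treated in the same way, with the two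
  actions on \<open>N\<close>.\<close>

lemma left_action_preserves_relators:
  assumes "l \<in> carrier L" and "x \<in> tensor_relators M R N"
  shows "frag_extend (\<lambda>(m, n). frag_of (l \<odot>\<^bsub>M\<^esub> m, n)) x \<in> tensor_relators M R N"
  using assms(2)
proof (cases rule: relators_cases)
  case (add_left m m' n)
  then show ?thesis
    using assms(1) relatorsI(1)[of "l \<odot>\<^bsub>M\<^esub> m" "l \<odot>\<^bsub>M\<^esub> m'" n]
    by (simp add: frag_extend_diff M.lsmult_r_distr)
next
  case (add_right m n n')
  then show ?thesis
    using assms(1) relatorsI(2)[of "l \<odot>\<^bsub>M\<^esub> m" n n'] by (simp add: frag_extend_diff)
next
  case (balanced m r n)
  then show ?thesis
    using assms(1) relatorsI(3)[of "l \<odot>\<^bsub>M\<^esub> m" r n]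
    by (simp add: frag_extend_diff M.smult_commute)
qed

lemma right_action_preserves_relators:
  assumes "s \<in> carrier S" and "x \<in> tensor_relators M R N"
  shows "frag_extend (\<lambda>(m, n). frag_of (m, n \<odot>\<^sub>r\<^bsub>N\<^esub> s)) x \<in> tensor_relators M R N"
  using assms(2)
proof (cases rule: relators_cases)
  case (add_left m m' n)
  then show ?thesis
    using assms(1) relatorsI(1)[of m m' "n \<odot>\<^sub>r\<^bsub>N\<^esub> s"] by (simp add: frag_extend_diff)
next
  case (add_right m n n')
  then show ?thesis
    using assms(1) relatorsI(2)[of m "n \<odot>\<^sub>r\<^bsub>N\<^esub> s" "n' \<odot>\<^sub>r\<^bsub>N\<^esub> s"]
    by (simp add: frag_extend_diff N.rsmult_l_distr)
next
  case (balanced m r n)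
  then show ?thesis
    using assms(1) relatorsI(3)[of m r "n \<odot>\<^sub>r\<^bsub>N\<^esub> s"]
    by (simp add: frag_extend_diff N.smult_commute)
qed

lemma lsmult_cls:
  assumes "l \<in> carrier L" and "keys_in c"
  shows "l \<odot>\<^bsub>W\<^esub> cls c = cls (frag_extend (\<lambda>(m, n). frag_of (l \<odot>\<^bsub>M\<^esub> m, n)) c)"
    and "keys_in (frag_extend (\<lambda>(m, n). frag_of (l \<odot>\<^bsub>M\<^esub> m, n)) c)"
  using induced_action[of "\<lambda>m n. (l \<odot>\<^bsub>M\<^esub> m, n)" c] assms
    left_action_preserves_relators[OF assms(1)] relator_mem_kernel
  by (auto simp: tensor_def Let_def)

lemma rsmult_cls:
  assumes "s \<in> carrier S" and "keys_in c"
  shows "cls c \<odot>\<^sub>r\<^bsub>W\<^esub> s = cls (frag_extend (\<lambda>(m, n). frag_of (m, n \<odot>\<^sub>r\<^bsub>N\<^esub> s)) c)"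
    and "keys_in (frag_extend (\<lambda>(m, n). frag_of (m, n \<odot>\<^sub>r\<^bsub>N\<^esub> s)) c)"
  using induced_action[of "\<lambda>m n. (m, n \<odot>\<^sub>r\<^bsub>N\<^esub> s)" c] assms
    right_action_preserves_relators[OF assms(1)] relator_mem_kernel
  by (auto simp: tensor_def Let_def)

lemma lsmult_tensor_elem:
  "\<lbrakk>l \<in> carrier L; m \<in> carrier M; n \<in> carrier N\<rbrakk> \<Longrightarrow> l \<odot>\<^bsub>W\<^esub> tn m n = tn (l \<odot>\<^bsub>M\<^esub> m) n"
  by (simp add: tensor_elem_conv lsmult_cls)

lemma rsmult_tensor_elem:
  "\<lbrakk>s \<in> carrier S; m \<in> carrier M; n \<in> carrier N\<rbrakk> \<Longrightarrow> tn m n \<odot>\<^sub>r\<^bsub>W\<^esub> s = tn m (n \<odot>\<^sub>r\<^bsub>N\<^esub> s)"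
  by (simp add: tensor_elem_conv rsmult_cls)

text \<open>Two additive maps that agree on generators agree everywhere. Only additivity is asked
  for, so the lemma applies to maps such as the action by a fixed scalar, which need not be linear
  over a noncommutative ring.\<close>

lemma tensor_hom_eqI:
  assumes "abelian_group A"
    and "f \<in> carrier W \<rightarrow> carrier A" and "g \<in> carrier W \<rightarrow> carrier A"
    and f: "\<And>C D. C \<in> carrier W \<Longrightarrow> D \<in> carrier W \<Longrightarrow> f (C \<oplus>\<^bsub>W\<^esub> D) = f C \<oplus>\<^bsub>A\<^esub> f D"
    and g: "\<And>C D. C \<in> carrier W \<Longrightarrow> D \<in> carrier W \<Longrightarrow> g (C \<oplus>\<^bsub>W\<^esub> D) = g C \<oplus>\<^bsub>A\<^esub> g D"
    and elem: "\<And>m n. m \<in> carrier M \<Longrightarrow> n \<in> carrier N \<Longrightarrow> f (tn m n) = g (tn m n)"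
    and "C \<in> carrier W"
  shows "f C = g C"
proof -
  interpret A: abelian_group A by fact
  interpret f: group_hom "add_monoid W" "add_monoid A" f
    using assms by (auto simp: group_hom_def group_hom_axioms_def hom_def W.a_group A.a_group)
  interpret g: group_hom "add_monoid W" "add_monoid A" g
    using assms by (auto simp: group_hom_def group_hom_axioms_def hom_def W.a_group A.a_group)
  have inv: "f (\<ominus>\<^bsub>W\<^esub> D) = \<ominus>\<^bsub>A\<^esub> f D" "g (\<ominus>\<^bsub>W\<^esub> D) = \<ominus>\<^bsub>A\<^esub> g D" if "D \<in> carrier W" for D
    using f.hom_inv g.hom_inv that by (simp_all flip: a_inv_def)
  show ?thesis
    using assms(7)
  proof (induction rule: tensor_induct)
    case zero
    then show ?case using f.hom_one g.hom_one by simp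
  next
    case (elem m n)
    then show ?case by (rule assms(6))
  next
    case (diff C D)
    then show ?case by (simp add: a_minus_def f g inv)
  qed
qed

lemma lsmult_tensor_closed: "l \<in> carrier L \<Longrightarrow> C \<in> carrier W \<Longrightarrow> l \<odot>\<^bsub>W\<^esub> C \<in> carrier W"
  by (elim tensor_cases) (simp add: lsmult_cls)

lemma rsmult_tensor_closed: "s \<in> carrier S \<Longrightarrow> C \<in> carrier W \<Longrightarrow> C \<odot>\<^sub>r\<^bsub>W\<^esub> s \<in> carrier W"
  by (elim tensor_cases) (simp add: rsmult_cls)

lemma lsmult_tensor_add:
  "\<lbrakk>l \<in> carrier L; C \<in> carrier W; D \<in> carrier W\<rbrakk> \<Longrightarrow>
    l \<odot>\<^bsub>W\<^esub> (C \<oplus>\<^bsub>W\<^esub> D) = l \<odot>\<^bsub>W\<^esub> C \<oplus>\<^bsub>W\<^esub> l \<odot>\<^bsub>W\<^esub> D"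
  by (elim tensor_cases) (simp add: lsmult_cls add_cls frag_extend_add keys_in_add)

lemma rsmult_tensor_add:
  "\<lbrakk>s \<in> carrier S; C \<in> carrier W; D \<in> carrier W\<rbrakk> \<Longrightarrow>
    (C \<oplus>\<^bsub>W\<^esub> D) \<odot>\<^sub>r\<^bsub>W\<^esub> s = C \<odot>\<^sub>r\<^bsub>W\<^esub> s \<oplus>\<^bsub>W\<^esub> D \<odot>\<^sub>r\<^bsub>W\<^esub> s"
  by (elim tensor_cases) (simp add: rsmult_cls add_cls frag_extend_add keys_in_add)

text \<open>For fixed scalars, both sides of each remaining axiom are additive in \<open>C\<close>,
  so it suffices to compare them on pure tensors. There the axiom comes from the corresponding one
  of \<open>M\<close> or \<open>N\<close>. Additivity of the two actions themselves is already
  known.\<close>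

lemma bimodule_tensor: "bimodule L S W"
proof -
  note closed = lsmult_tensor_closed rsmult_tensor_closed
  note additive = lsmult_tensor_add rsmult_tensor_add
  note elem = lsmult_tensor_elem rsmult_tensor_elem
  note eqI = tensor_hom_eqI[OF W.abelian_group_axioms]
  show ?thesis
  proof (intro bimodule.intro bimodule_axioms.intro)
    show "ring L" "ring S" "abelian_group W" by unfold_locales
  next
    fix C assume "C \<in> carrier W"
    then show "\<one>\<^bsub>L\<^esub> \<odot>\<^bsub>W\<^esub> C = C"
      \<comment> \<open>\<open>rotated -1\<close> moves the membership of \<open>C\<close> to the
        front, where the chained fact discharges it; the other premises are left to the
        simplifier.\<close>
      by (rule eqI[where f = "\<lambda>C. \<one>\<^bsub>L\<^esub> \<odot>\<^bsub>W\<^esub> C" and g = "\<lambda>C. C", rotated -1])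
        (simp_all add: closed additive elem M.lsmult_one)
  next
    fix C assume "C \<in> carrier W"
    then show "C \<odot>\<^sub>r\<^bsub>W\<^esub> \<one>\<^bsub>S\<^esub> = C"
      by (rule eqI[where f = "\<lambda>C. C \<odot>\<^sub>r\<^bsub>W\<^esub> \<one>\<^bsub>S\<^esub>" and g = "\<lambda>C. C", rotated -1])
        (simp_all add: closed additive elem N.rsmult_one)
  next
    fix a b C assume ab: "a \<in> carrier L" "b \<in> carrier L" and "C \<in> carrier W"
    from this(3) show "(a \<oplus>\<^bsub>L\<^esub> b) \<odot>\<^bsub>W\<^esub> C = a \<odot>\<^bsub>W\<^esub> C \<oplus>\<^bsub>W\<^esub> b \<odot>\<^bsub>W\<^esub> C"
      by (rule eqI[where f = "\<lambda>C. (a \<oplus>\<^bsub>L\<^esub> b) \<odot>\<^bsub>W\<^esub> C"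
            and g = "\<lambda>C. a \<odot>\<^bsub>W\<^esub> C \<oplus>\<^bsub>W\<^esub> b \<odot>\<^bsub>W\<^esub> C", rotated -1])
        (simp_all add: ab closed additive elem M.lsmult_l_distr tensor_elem_add_left W.a_ac)
  next
    fix a b C assume ab: "a \<in> carrier L" "b \<in> carrier L" and "C \<in> carrier W"
    from this(3) show "(a \<otimes>\<^bsub>L\<^esub> b) \<odot>\<^bsub>W\<^esub> C = a \<odot>\<^bsub>W\<^esub> (b \<odot>\<^bsub>W\<^esub> C)"
      by (rule eqI[where f = "\<lambda>C. (a \<otimes>\<^bsub>L\<^esub> b) \<odot>\<^bsub>W\<^esub> C"
            and g = "\<lambda>C. a \<odot>\<^bsub>W\<^esub> (b \<odot>\<^bsub>W\<^esub> C)", rotated -1])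
        (simp_all add: ab closed additive elem M.lsmult_assoc)
  next
    fix C s t assume st: "s \<in> carrier S" "t \<in> carrier S" and "C \<in> carrier W"
    from this(3) show "C \<odot>\<^sub>r\<^bsub>W\<^esub> (s \<oplus>\<^bsub>S\<^esub> t) = C \<odot>\<^sub>r\<^bsub>W\<^esub> s \<oplus>\<^bsub>W\<^esub> C \<odot>\<^sub>r\<^bsub>W\<^esub> t"
      by (rule eqI[where f = "\<lambda>C. C \<odot>\<^sub>r\<^bsub>W\<^esub> (s \<oplus>\<^bsub>S\<^esub> t)"
            and g = "\<lambda>C. C \<odot>\<^sub>r\<^bsub>W\<^esub> s \<oplus>\<^bsub>W\<^esub> C \<odot>\<^sub>r\<^bsub>W\<^esub> t", rotated -1])
        (simp_all add: st closed additive elem N.rsmult_r_distr tensor_elem_add_right W.a_ac)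
  next
    fix C s t assume st: "s \<in> carrier S" "t \<in> carrier S" and "C \<in> carrier W"
    from this(3) show "C \<odot>\<^sub>r\<^bsub>W\<^esub> (s \<otimes>\<^bsub>S\<^esub> t) = (C \<odot>\<^sub>r\<^bsub>W\<^esub> s) \<odot>\<^sub>r\<^bsub>W\<^esub> t"
      by (rule eqI[where f = "\<lambda>C. C \<odot>\<^sub>r\<^bsub>W\<^esub> (s \<otimes>\<^bsub>S\<^esub> t)"
            and g = "\<lambda>C. (C \<odot>\<^sub>r\<^bsub>W\<^esub> s) \<odot>\<^sub>r\<^bsub>W\<^esub> t", rotated -1])
        (simp_all add: st closed additive elem N.rsmult_assoc)
  next
    fix a C s assume as: "a \<in> carrier L" "s \<in> carrier S" and "C \<in> carrier W"
    from this(3) show "(a \<odot>\<^bsub>W\<^esub> C) \<odot>\<^sub>r\<^bsub>W\<^esub> s = a \<odot>\<^bsub>W\<^esub> (C \<odot>\<^sub>r\<^bsub>W\<^esub> s)"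
      by (rule eqI[where f = "\<lambda>C. (a \<odot>\<^bsub>W\<^esub> C) \<odot>\<^sub>r\<^bsub>W\<^esub> s"
            and g = "\<lambda>C. a \<odot>\<^bsub>W\<^esub> (C \<odot>\<^sub>r\<^bsub>W\<^esub> s)", rotated -1])
        (simp_all add: as closed additive elem)
  qed (simp_all add: closed additive)
qed

section \<open>The universal property of the tensor product\<close>

context
  fixes A :: "('a, 'h) ring_scheme" and b :: "'m \<Rightarrow> 'n \<Rightarrow> 'a"
  assumes A: "abelian_group A"
    and closed: "\<And>m n. m \<in> carrier M \<Longrightarrow> n \<in> carrier N \<Longrightarrow> b m n \<in> carrier A"
    and add_left: "\<And>m m' n. \<lbrakk>m \<in> carrier M; m' \<in> carrier M; n \<in> carrier N\<rbrakk> \<Longrightarrow>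
      b (m \<oplus>\<^bsub>M\<^esub> m') n = b m n \<oplus>\<^bsub>A\<^esub> b m' n"
    and add_right: "\<And>m n n'. \<lbrakk>m \<in> carrier M; n \<in> carrier N; n' \<in> carrier N\<rbrakk> \<Longrightarrow>
      b m (n \<oplus>\<^bsub>N\<^esub> n') = b m n \<oplus>\<^bsub>A\<^esub> b m n'"
    and balanced: "\<And>m r n. \<lbrakk>m \<in> carrier M; r \<in> carrier R; n \<in> carrier N\<rbrakk> \<Longrightarrow>
      b (m \<odot>\<^sub>r\<^bsub>M\<^esub> r) n = b m (r \<odot>\<^bsub>N\<^esub> n)"
begin

interpretation A: abelian_group A by (rule A)

interpretation ev: group_hom F "add_monoid A" "frag_eval A (\<lambda>(m, n). b m n)"
  by (rule A.frag_eval_hom) (auto simp: closed)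

lemma frag_eval_diff:
  assumes "keys_in c" "keys_in d"
  shows "frag_eval A (\<lambda>(m, n). b m n) (c - d) =
    frag_eval A (\<lambda>(m, n). b m n) c \<ominus>\<^bsub>A\<^esub> frag_eval A (\<lambda>(m, n). b m n) d"
  using ev.hom_mult[of c "- d"] ev.hom_inv[of d] assms
  by (simp add: a_minus_def flip: a_inv_def)

text \<open>Biadditivity and balancedness of \<open>b\<close> say exactly that the relators evaluate
  to zero, and the trivial subgroup then receives everything they generate.\<close>

lemma frag_eval_kernel:
  assumes "k \<in> K"
  shows "frag_eval A (\<lambda>(m, n). b m n) k = \<zero>\<^bsub>A\<^esub>"
proof -
  \<comment> \<open>\<open>cancel\<close> handles the value of an additivity relator and
    \<open>minus_self\<close> that of a balancing relator.\<close>
  have cancel: "x \<oplus>\<^bsub>A\<^esub> y \<ominus>\<^bsub>A\<^esub> x \<ominus>\<^bsub>A\<^esub> y = \<zero>\<^bsub>A\<^esub>" if "x \<in> carrier A" "y \<in> carrier A" for x y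
    using that A.add.m_comm[of x y] by (simp add: a_minus_def A.a_assoc A.r_neg)
  have minus_self: "x \<ominus>\<^bsub>A\<^esub> x = \<zero>\<^bsub>A\<^esub>" if "x \<in> carrier A" for x
    using that by (simp add: a_minus_def A.r_neg)
  have "frag_eval A (\<lambda>(m, n). b m n) x = \<zero>\<^bsub>A\<^esub>" if "x \<in> tensor_relators M R N" for x
    using that
    by (cases rule: relators_cases) (simp_all add: frag_eval_diff keys_in_diff A.frag_eval_of
        closed add_left add_right balanced cancel minus_self)
  then show ?thesis
    using generate_hom_mem_subgroup[OF ev.group_hom_axioms _ relators_subset, of "{\<zero>\<^bsub>A\<^esub>}" k]
      A.add.triv_subgroup assms
    by (auto simp: tensor_kernel_def)
qed

text \<open>Representatives of a coset differ by elements of \<open>K\<close>, which evaluate to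
  zero. The image of the coset is therefore a singleton, and \<open>the_elem\<close> returns the
  common value.\<close>

lemma tensor_lift_cls:
  assumes "keys_in c"
  shows "tensor_lift A b (cls c) = frag_eval A (\<lambda>(m, n). b m n) c"
proof -
  have "frag_eval A (\<lambda>(m, n). b m n) (k + c) = frag_eval A (\<lambda>(m, n). b m n) c" if "k \<in> K" for k
    using ev.hom_mult[of k c] K.subset that assms ev.hom_closed[of c]
    by (auto simp: frag_eval_kernel)
  then have "frag_eval A (\<lambda>(m, n). b m n) ` cls c = {frag_eval A (\<lambda>(m, n). b m n) c}"
    using K.one_closed by (fastforce simp: cls_def r_coset_def)
  then show ?thesis by (simp add: tensor_lift_def)
qed

lemma tensor_lift_closed: "C \<in> carrier W \<Longrightarrow> tensor_lift A b C \<in> carrier A"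
  by (elim tensor_cases) (use ev.hom_closed in \<open>simp add: tensor_lift_cls\<close>)

lemma tensor_lift_add:
  "C \<in> carrier W \<Longrightarrow> D \<in> carrier W \<Longrightarrow>
    tensor_lift A b (C \<oplus>\<^bsub>W\<^esub> D) = tensor_lift A b C \<oplus>\<^bsub>A\<^esub> tensor_lift A b D"
  by (elim tensor_cases) (use ev.hom_mult in \<open>simp add: tensor_lift_cls add_cls keys_in_add\<close>)

lemma tensor_lift_elem:
  "m \<in> carrier M \<Longrightarrow> n \<in> carrier N \<Longrightarrow> tensor_lift A b (tn m n) = b m n"
  by (simp add: tensor_elem_conv tensor_lift_cls A.frag_eval_of closed)

end

text \<open>For a fixed scalar, acting before or after the lift gives two additive maps, and the
  assumptions \<open>left\<close> and \<open>right\<close> make them agree on pure tensors.\<close>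

lemma tensor_lift_hom:
  assumes P: "bimodule L S P"
    and closed: "\<And>m n. m \<in> carrier M \<Longrightarrow> n \<in> carrier N \<Longrightarrow> b m n \<in> carrier P"
    and add_left: "\<And>m m' n. \<lbrakk>m \<in> carrier M; m' \<in> carrier M; n \<in> carrier N\<rbrakk> \<Longrightarrow>
      b (m \<oplus>\<^bsub>M\<^esub> m') n = b m n \<oplus>\<^bsub>P\<^esub> b m' n"
    and add_right: "\<And>m n n'. \<lbrakk>m \<in> carrier M; n \<in> carrier N; n' \<in> carrier N\<rbrakk> \<Longrightarrow>
      b m (n \<oplus>\<^bsub>N\<^esub> n') = b m n \<oplus>\<^bsub>P\<^esub> b m n'"
    and balanced: "\<And>m r n. \<lbrakk>m \<in> carrier M; r \<in> carrier R; n \<in> carrier N\<rbrakk> \<Longrightarrow>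
      b (m \<odot>\<^sub>r\<^bsub>M\<^esub> r) n = b m (r \<odot>\<^bsub>N\<^esub> n)"
    and left: "\<And>l m n. \<lbrakk>l \<in> carrier L; m \<in> carrier M; n \<in> carrier N\<rbrakk> \<Longrightarrow>
      b (l \<odot>\<^bsub>M\<^esub> m) n = l \<odot>\<^bsub>P\<^esub> b m n"
    and right: "\<And>m n s. \<lbrakk>m \<in> carrier M; n \<in> carrier N; s \<in> carrier S\<rbrakk> \<Longrightarrow>
      b m (n \<odot>\<^sub>r\<^bsub>N\<^esub> s) = b m n \<odot>\<^sub>r\<^bsub>P\<^esub> s"
  shows "tensor_lift P b \<in> bimodule_hom L S W P"
proof -
  interpret P: bimodule L S P by fact
  note P_group = P.M.abelian_group_axioms
  note lift_closed = tensor_lift_closed[OF P_group closed add_left add_right balanced]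
  note lift_add = tensor_lift_add[OF P_group closed add_left add_right balanced]
  note lift_elem = tensor_lift_elem[OF P_group closed add_left add_right balanced]
  have "tensor_lift P b (l \<odot>\<^bsub>W\<^esub> C) = l \<odot>\<^bsub>P\<^esub> tensor_lift P b C"
    if "l \<in> carrier L" "C \<in> carrier W" for l C
    using that(2)
    by (rule tensor_hom_eqI[OF P_group, where f = "\<lambda>C. tensor_lift P b (l \<odot>\<^bsub>W\<^esub> C)"
          and g = "\<lambda>C. l \<odot>\<^bsub>P\<^esub> tensor_lift P b C", rotated -1])
      (simp_all add: that(1) lift_closed lift_add lift_elem lsmult_tensor_closed
          lsmult_tensor_add lsmult_tensor_elem left P.lsmult_r_distr)
  moreover have "tensor_lift P b (C \<odot>\<^sub>r\<^bsub>W\<^esub> s) = tensor_lift P b C \<odot>\<^sub>r\<^bsub>P\<^esub> s"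
    if "s \<in> carrier S" "C \<in> carrier W" for s C
    using that(2)
    by (rule tensor_hom_eqI[OF P_group, where f = "\<lambda>C. tensor_lift P b (C \<odot>\<^sub>r\<^bsub>W\<^esub> s)"
          and g = "\<lambda>C. tensor_lift P b C \<odot>\<^sub>r\<^bsub>P\<^esub> s", rotated -1])
      (simp_all add: that(1) lift_closed lift_add lift_elem rsmult_tensor_closed
          rsmult_tensor_add rsmult_tensor_elem right P.rsmult_l_distr)
  ultimately show ?thesis
    by (auto simp: bimodule_hom_def lift_closed lift_add)
qed

end


section \<open>Bimodule homomorphisms and direct summands\<close>

lemma bimodule_hom_group_hom:
  assumes "bimodule L S N" and "bimodule L S P" and "f \<in> bimodule_hom L S N P"
  shows "group_hom (add_monoid N) (add_monoid P) f"
proof -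
  interpret N: bimodule L S N by fact
  interpret P: bimodule L S P by fact
  show ?thesis
    using assms(3)
    by (auto simp: bimodule_hom_def group_hom_def group_hom_axioms_def hom_def
        N.M.a_group P.M.a_group)
qed

lemma bimodule_hom_compose:
  assumes "f \<in> bimodule_hom L S M N" and "g \<in> bimodule_hom L S N P"
  shows "g \<circ> f \<in> bimodule_hom L S M P"
  using assms by (simp add: bimodule_hom_def Pi_iff)

lemma subbimodule_closed:
  assumes "subbimodule L S A N"
  shows "\<And>x. x \<in> A \<Longrightarrow> x \<in> carrier N" and "\<zero>\<^bsub>N\<^esub> \<in> A"
    and "\<And>x y. x \<in> A \<Longrightarrow> y \<in> A \<Longrightarrow> x \<oplus>\<^bsub>N\<^esub> y \<in> A"
    and "\<And>x. x \<in> A \<Longrightarrow> \<ominus>\<^bsub>N\<^esub> x \<in> A"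
    and "\<And>l x. l \<in> carrier L \<Longrightarrow> x \<in> A \<Longrightarrow> l \<odot>\<^bsub>N\<^esub> x \<in> A"
    and "\<And>s x. s \<in> carrier S \<Longrightarrow> x \<in> A \<Longrightarrow> x \<odot>\<^sub>r\<^bsub>N\<^esub> s \<in> A"
proof -
  have "subgroup A (add_monoid N)" using assms by (simp add: subbimodule_def)
  then interpret A: subgroup A "add_monoid N" .
  show "\<And>x. x \<in> A \<Longrightarrow> x \<in> carrier N" "\<zero>\<^bsub>N\<^esub> \<in> A"
    and "\<And>x y. x \<in> A \<Longrightarrow> y \<in> A \<Longrightarrow> x \<oplus>\<^bsub>N\<^esub> y \<in> A"
    and "\<And>x. x \<in> A \<Longrightarrow> \<ominus>\<^bsub>N\<^esub> x \<in> A"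
    using A.mem_carrier A.one_closed A.m_closed A.m_inv_closed by (simp_all add: a_inv_def)
qed (use assms in \<open>simp_all add: subbimodule_def\<close>)

lemma (in bimodule) subbimoduleI:
  assumes "\<And>x. x \<in> A \<Longrightarrow> x \<in> carrier M" and "\<zero> \<in> A"
    and "\<And>x y. x \<in> A \<Longrightarrow> y \<in> A \<Longrightarrow> x \<oplus> y \<in> A"
    and "\<And>x. x \<in> A \<Longrightarrow> \<ominus> x \<in> A"
    and "\<And>l x. l \<in> carrier L \<Longrightarrow> x \<in> A \<Longrightarrow> l \<odot> x \<in> A"
    and "\<And>s x. s \<in> carrier R \<Longrightarrow> x \<in> A \<Longrightarrow> x \<odot>\<^sub>r s \<in> A"
  shows "subbimodule L R A M"
  unfolding subbimodule_def
proof (intro conjI ballI)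
  show "subgroup A (add_monoid M)"
    by (rule M.add.subgroupI) (use assms(1-4) in auto)
qed (simp_all add: assms)

section \<open>Split epimorphisms and direct summands\<close>

lemma split_epi_imp_direct_summand:
  assumes N: "bimodule L S N" and P: "bimodule L S P" and "split_epi L S N P \<phi>"
  shows "\<exists>A. direct_summand L S A N \<and> bimodule_iso L S P (N\<lparr>carrier := A\<rparr>)"
proof -
  interpret N: bimodule L S N by fact
  interpret P: bimodule L S P by fact
  obtain g where \<phi>: "\<phi> \<in> bimodule_hom L S N P" and g: "g \<in> bimodule_hom L S P N"
    and \<phi>g: "\<And>y. y \<in> carrier P \<Longrightarrow> \<phi> (g y) = y"
    using assms(3) by (auto simp: split_epi_def)
  interpret \<phi>: group_hom "add_monoid N" "add_monoid P" \<phi>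
    by (rule bimodule_hom_group_hom[OF N P \<phi>])
  interpret g: group_hom "add_monoid P" "add_monoid N" g
    by (rule bimodule_hom_group_hom[OF P N g])
  have \<phi>_minus: "\<phi> (\<ominus>\<^bsub>N\<^esub> x) = \<ominus>\<^bsub>P\<^esub> \<phi> x" if "x \<in> carrier N" for x
    using \<phi>.hom_inv that by (simp flip: a_inv_def)
  have g_minus: "g (\<ominus>\<^bsub>P\<^esub> x) = \<ominus>\<^bsub>N\<^esub> g x" if "x \<in> carrier P" for x
    using g.hom_inv that by (simp flip: a_inv_def)
  have \<phi>_hom: "x \<in> carrier N \<Longrightarrow> \<phi> x \<in> carrier P"
    "\<lbrakk>x \<in> carrier N; y \<in> carrier N\<rbrakk> \<Longrightarrow> \<phi> (x \<oplus>\<^bsub>N\<^esub> y) = \<phi> x \<oplus>\<^bsub>P\<^esub> \<phi> y"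
    "\<lbrakk>l \<in> carrier L; x \<in> carrier N\<rbrakk> \<Longrightarrow> \<phi> (l \<odot>\<^bsub>N\<^esub> x) = l \<odot>\<^bsub>P\<^esub> \<phi> x"
    "\<lbrakk>s \<in> carrier S; x \<in> carrier N\<rbrakk> \<Longrightarrow> \<phi> (x \<odot>\<^sub>r\<^bsub>N\<^esub> s) = \<phi> x \<odot>\<^sub>r\<^bsub>P\<^esub> s" for x y l s
    using \<phi> by (auto simp: bimodule_hom_def)
  have g_zero: "g \<zero>\<^bsub>P\<^esub> = \<zero>\<^bsub>N\<^esub>" and \<phi>_zero: "\<phi> \<zero>\<^bsub>N\<^esub> = \<zero>\<^bsub>P\<^esub>"
    using g.hom_one \<phi>.hom_one by simp_all
  have g_closed: "g x \<in> carrier N" if "x \<in> carrier P" for x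
    using g that by (auto simp: bimodule_hom_def)
  have g_hom: "\<lbrakk>x \<in> carrier P; y \<in> carrier P\<rbrakk> \<Longrightarrow> g x \<oplus>\<^bsub>N\<^esub> g y = g (x \<oplus>\<^bsub>P\<^esub> y)"
    "\<lbrakk>l \<in> carrier L; x \<in> carrier P\<rbrakk> \<Longrightarrow> l \<odot>\<^bsub>N\<^esub> g x = g (l \<odot>\<^bsub>P\<^esub> x)"
    "\<lbrakk>s \<in> carrier S; x \<in> carrier P\<rbrakk> \<Longrightarrow> g x \<odot>\<^sub>r\<^bsub>N\<^esub> s = g (x \<odot>\<^sub>r\<^bsub>P\<^esub> s)"
    "x \<in> carrier P \<Longrightarrow> \<ominus>\<^bsub>N\<^esub> g x = g (\<ominus>\<^bsub>P\<^esub> x)" for x y l s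
    using g g_minus by (auto simp: bimodule_hom_def)
  \<comment> \<open>The summand is the image of the section, and its complement is the kernel of the
    epimorphism.\<close>
  define A where "A = g ` carrier P"
  define B where "B = {x \<in> carrier N. \<phi> x = \<zero>\<^bsub>P\<^esub>}"
  have A: "subbimodule L S A N"
  proof (rule N.subbimoduleI)
    show "\<zero>\<^bsub>N\<^esub> \<in> A"
      unfolding A_def by (rule image_eqI[of _ _ "\<zero>\<^bsub>P\<^esub>"]) (simp_all add: g_zero)
  qed (auto simp: A_def g_closed g_hom)
  \<comment> \<open>Apply distributivity to a sum of two zeros and cancel. This and
    \<open>zero_rsmult\<close> make the kernel \<open>B\<close> stable under the actions.\<close>
  have zero_smult: "l \<odot>\<^bsub>P\<^esub> \<zero>\<^bsub>P\<^esub> = \<zero>\<^bsub>P\<^esub>" if "l \<in> carrier L" for l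
    using P.lsmult_r_distr[of l "\<zero>\<^bsub>P\<^esub>" "\<zero>\<^bsub>P\<^esub>"] that by simp
  have zero_rsmult: "\<zero>\<^bsub>P\<^esub> \<odot>\<^sub>r\<^bsub>P\<^esub> s = \<zero>\<^bsub>P\<^esub>" if "s \<in> carrier S" for s
    using P.rsmult_l_distr[of "\<zero>\<^bsub>P\<^esub>" "\<zero>\<^bsub>P\<^esub>" s] that by simp
  have B: "subbimodule L S B N"
    by (rule N.subbimoduleI) (auto simp: B_def \<phi>_hom \<phi>_zero \<phi>_minus zero_smult zero_rsmult)
  have "A <+>\<^bsub>N\<^esub> B = carrier N"
  proof
    show "A <+>\<^bsub>N\<^esub> B \<subseteq> carrier N"
      using subbimodule_closed(1)[OF A] subbimodule_closed(1)[OF B] by (auto simp: set_add_def')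
    show "carrier N \<subseteq> A <+>\<^bsub>N\<^esub> B"
    proof
      fix x assume x: "x \<in> carrier N"
      \<comment> \<open>Subtracting \<open>g (\<phi> x)\<close> from \<open>x\<close> leaves an
        element of the kernel, because \<open>\<phi> (g (\<phi> x)) = \<phi> x\<close>.\<close>
      let ?a = "g (\<phi> x)"
      have a: "?a \<in> carrier N" "?a \<in> A" using x by (auto simp: A_def g_closed \<phi>_hom)
      have "\<ominus>\<^bsub>N\<^esub> ?a \<oplus>\<^bsub>N\<^esub> x \<in> B"
        using x a by (simp add: B_def \<phi>_hom \<phi>_minus \<phi>g P.M.l_neg)
      moreover have "x = ?a \<oplus>\<^bsub>N\<^esub> (\<ominus>\<^bsub>N\<^esub> ?a \<oplus>\<^bsub>N\<^esub> x)"
        using x a by (simp add: N.M.r_neg2)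
      ultimately show "x \<in> A <+>\<^bsub>N\<^esub> B" using a(2) by (auto simp: set_add_def')
    qed
  qed
  moreover have "A \<inter> B = {\<zero>\<^bsub>N\<^esub>}"
  proof -
    \<comment> \<open>If \<open>x = g y\<close> lies in the kernel, then
      \<open>y = \<phi> (g y)\<close> is zero, and so is \<open>x = g y\<close>.\<close>
    have "x = \<zero>\<^bsub>N\<^esub>" if "x \<in> A" "x \<in> B" for x
      using that g_zero by (auto simp: A_def B_def \<phi>g)
    then show ?thesis
      using subbimodule_closed(2)[OF A] subbimodule_closed(2)[OF B] by blast
  qed
  ultimately have "direct_summand L S A N"
    using A B by (auto simp: direct_summand_def)
  moreover have "g \<in> bimodule_hom L S P (N\<lparr>carrier := A\<rparr>)"
    using g by (auto simp: bimodule_hom_def A_def)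
  moreover have "bij_betw g (carrier P) A"
    unfolding A_def by (intro inj_on_imp_bij_betw inj_on_inverseI[of _ \<phi>] \<phi>g)
  ultimately show ?thesis by (auto simp: bimodule_iso_def)
qed

text \<open>The epimorphism is the projection onto \<open>A\<close> along \<open>B\<close> followed
  by the inverse of the isomorphism \<open>f\<close>; the section is \<open>f\<close> itself, viewed
  as a map into \<open>N\<close>.\<close>

lemma direct_summand_imp_split_epi:
  assumes N: "bimodule L S N" and P: "bimodule L S P"
    and "direct_summand L S A N" and "bimodule_iso L S P (N\<lparr>carrier := A\<rparr>)"
  shows "\<exists>\<phi>. split_epi L S N P \<phi>"
proof -
  interpret N: bimodule L S N by fact
  interpret P: bimodule L S P by fact
  obtain B where A: "subbimodule L S A N" and B: "subbimodule L S B N"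
    and sum: "A <+>\<^bsub>N\<^esub> B = carrier N" and int: "A \<inter> B = {\<zero>\<^bsub>N\<^esub>}"
    using assms(3) by (auto simp: direct_summand_def)
  obtain f where f: "f \<in> bimodule_hom L S P (N\<lparr>carrier := A\<rparr>)" and bij: "bij_betw f (carrier P) A"
    using assms(4) by (auto simp: bimodule_iso_def)
  note B_closed = subbimodule_closed[OF B]
  have f_A: "f x \<in> A" if "x \<in> carrier P" for x
    using f that by (auto simp: bimodule_hom_def)
  then have f_closed: "f x \<in> carrier N" if "x \<in> carrier P" for x
    using subbimodule_closed(1)[OF A] that by blast
  have f_hom: "f (x \<oplus>\<^bsub>P\<^esub> y) = f x \<oplus>\<^bsub>N\<^esub> f y"
    "l \<in> carrier L \<Longrightarrow> f (l \<odot>\<^bsub>P\<^esub> x) = l \<odot>\<^bsub>N\<^esub> f x"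
    "s \<in> carrier S \<Longrightarrow> f (x \<odot>\<^sub>r\<^bsub>P\<^esub> s) = f x \<odot>\<^sub>r\<^bsub>N\<^esub> s"
    if "x \<in> carrier P" "y \<in> carrier P" for x y l s
    using f that by (auto simp: bimodule_hom_def)
  have f_in_hom: "f \<in> bimodule_hom L S P N"
    using f f_closed by (auto simp: bimodule_hom_def)
  \<comment> \<open>The difference of \<open>f y\<close> and \<open>f y'\<close> lies in
    \<open>A\<close> and equals the difference of \<open>b'\<close> and \<open>b\<close>, which lies
    in \<open>B\<close>. It vanishes since the two meet only in zero, and \<open>f\<close> is
    injective.\<close>
  have unique: "y = y'"
    if "y \<in> carrier P" "y' \<in> carrier P" "b \<in> B" "b' \<in> B" "f y \<oplus>\<^bsub>N\<^esub> b = f y' \<oplus>\<^bsub>N\<^esub> b'" for y y' b b'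
  proof -
    have carrier: "f y \<in> carrier N" "f y' \<in> carrier N" "b \<in> carrier N" "b' \<in> carrier N"
      using that f_closed B_closed(1) by auto
    have "\<ominus>\<^bsub>N\<^esub> f y' \<oplus>\<^bsub>N\<^esub> f y = (\<ominus>\<^bsub>N\<^esub> f y' \<oplus>\<^bsub>N\<^esub> (f y \<oplus>\<^bsub>N\<^esub> b)) \<oplus>\<^bsub>N\<^esub> \<ominus>\<^bsub>N\<^esub> b"
      using carrier by (simp add: N.M.a_assoc N.M.r_neg)
    also have "\<dots> = b' \<oplus>\<^bsub>N\<^esub> \<ominus>\<^bsub>N\<^esub> b"
      using carrier by (simp add: that(5) N.M.r_neg1)
    finally have "\<ominus>\<^bsub>N\<^esub> f y' \<oplus>\<^bsub>N\<^esub> f y \<in> B"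
      using that by (simp add: B_closed(3,4))
    moreover have "\<ominus>\<^bsub>N\<^esub> f y' \<oplus>\<^bsub>N\<^esub> f y \<in> A"
      using that by (simp add: f_A subbimodule_closed(3,4)[OF A])
    ultimately have "\<ominus>\<^bsub>N\<^esub> f y' \<oplus>\<^bsub>N\<^esub> f y = \<zero>\<^bsub>N\<^esub>" using int by blast
    then have "f y = f y'"
      using carrier N.M.r_neg2[of "f y'" "f y"] by simp
    then show "y = y'" using bij that by (auto simp: bij_betw_def inj_on_def)
  qed
  \<comment> \<open>The \<open>P\<close>-coordinate of \<open>x\<close>. It exists because
    \<open>A\<close> and \<open>B\<close> span \<open>N\<close>, and \<open>unique\<close> justifies
    the description operator.\<close>
  define \<phi> where "\<phi> x = (THE y. y \<in> carrier P \<and> (\<exists>b\<in>B. x = f y \<oplus>\<^bsub>N\<^esub> b))" for x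
  have \<phi>_eq: "\<phi> (f y \<oplus>\<^bsub>N\<^esub> b) = y" if "y \<in> carrier P" "b \<in> B" for y b
    unfolding \<phi>_def by (rule the_equality) (use that unique in blast)+
  have decomp: "\<exists>y b. y \<in> carrier P \<and> b \<in> B \<and> x = f y \<oplus>\<^bsub>N\<^esub> b" if x: "x \<in> carrier N" for x
  proof -
    from x obtain a b where "a \<in> A" "b \<in> B" "x = a \<oplus>\<^bsub>N\<^esub> b"
      unfolding sum[symmetric] set_add_def' by blast
    moreover from this(1) obtain y where "y \<in> carrier P" "a = f y"
      using bij by (auto simp: bij_betw_def)
    ultimately show ?thesis by blast
  qed
  have "\<phi> \<in> bimodule_hom L S N P"
    unfolding bimodule_hom_def
  proof (intro CollectI conjI ballI Pi_I)
    fix x assume "x \<in> carrier N"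
    then obtain y b where yb: "y \<in> carrier P" "b \<in> B" and x: "x = f y \<oplus>\<^bsub>N\<^esub> b" using decomp by blast
    note carrier = yb f_closed B_closed(1)
    from yb show "\<phi> x \<in> carrier P" by (simp add: x \<phi>_eq)
    { fix x' assume "x' \<in> carrier N"
      then obtain y' b' where yb': "y' \<in> carrier P" "b' \<in> B" and x': "x' = f y' \<oplus>\<^bsub>N\<^esub> b'"
        using decomp by blast
      have "x \<oplus>\<^bsub>N\<^esub> x' = f (y \<oplus>\<^bsub>P\<^esub> y') \<oplus>\<^bsub>N\<^esub> (b \<oplus>\<^bsub>N\<^esub> b')"
        using carrier yb' by (simp add: x x' f_hom N.M.a_ac)
      then show "\<phi> (x \<oplus>\<^bsub>N\<^esub> x') = \<phi> x \<oplus>\<^bsub>P\<^esub> \<phi> x'"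
        using \<phi>_eq[of "y \<oplus>\<^bsub>P\<^esub> y'" "b \<oplus>\<^bsub>N\<^esub> b'"] yb yb' B_closed(3) by (simp add: x x' \<phi>_eq)
    }
    { fix l assume l: "l \<in> carrier L"
      have "l \<odot>\<^bsub>N\<^esub> x = f (l \<odot>\<^bsub>P\<^esub> y) \<oplus>\<^bsub>N\<^esub> l \<odot>\<^bsub>N\<^esub> b"
        using carrier l by (simp add: x f_hom(2)[of y y] N.lsmult_r_distr)
      then show "\<phi> (l \<odot>\<^bsub>N\<^esub> x) = l \<odot>\<^bsub>P\<^esub> \<phi> x"
        using \<phi>_eq[of "l \<odot>\<^bsub>P\<^esub> y" "l \<odot>\<^bsub>N\<^esub> b"] yb l B_closed(5) by (simp add: x \<phi>_eq)
    }
    { fix s assume s: "s \<in> carrier S"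
      have "x \<odot>\<^sub>r\<^bsub>N\<^esub> s = f (y \<odot>\<^sub>r\<^bsub>P\<^esub> s) \<oplus>\<^bsub>N\<^esub> b \<odot>\<^sub>r\<^bsub>N\<^esub> s"
        using carrier s by (simp add: x f_hom(3)[of y y] N.rsmult_l_distr)
      then show "\<phi> (x \<odot>\<^sub>r\<^bsub>N\<^esub> s) = \<phi> x \<odot>\<^sub>r\<^bsub>P\<^esub> s"
        using \<phi>_eq[of "y \<odot>\<^sub>r\<^bsub>P\<^esub> s" "b \<odot>\<^sub>r\<^bsub>N\<^esub> s"] yb s B_closed(6) by (simp add: x \<phi>_eq)
    }
  qed
  \<comment> \<open>The decomposition of \<open>f y\<close> has zero as its component in
    \<open>B\<close>.\<close>
  moreover have "\<phi> (f y) = y" if "y \<in> carrier P" for y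
    using \<phi>_eq[OF that B_closed(2)] f_closed[OF that] by simp
  ultimately show ?thesis using f_in_hom by (auto simp: split_epi_def)
qed


section \<open>The left dual and separability\<close>

lemma regular_bimodule_simps [simp]:
  "carrier (regular_bimodule T) = carrier T"
  "\<zero>\<^bsub>regular_bimodule T\<^esub> = \<zero>\<^bsub>T\<^esub>"
  "x \<oplus>\<^bsub>regular_bimodule T\<^esub> y = x \<oplus>\<^bsub>T\<^esub> y"
  "x \<odot>\<^bsub>regular_bimodule T\<^esub> y = x \<otimes>\<^bsub>T\<^esub> y"
  "x \<odot>\<^sub>r\<^bsub>regular_bimodule T\<^esub> y = x \<otimes>\<^bsub>T\<^esub> y"
  by (simp_all add: regular_bimodule_def)

lemma (in ring) bimodule_regular: "bimodule R R (regular_bimodule R)"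
proof -
  have "abelian_group (regular_bimodule R)"
    by (rule abelian_groupI) (auto simp: a_ac intro: bexI[of _ "\<ominus> x" for x] l_neg)
  then show ?thesis
    by (auto simp: bimodule_def bimodule_axioms_def ring_axioms l_distr r_distr m_assoc)
qed

lemma left_dual_simps:
  "\<zero>\<^bsub>left_dual T M\<^esub> = (\<lambda>m\<in>carrier M. \<zero>\<^bsub>T\<^esub>)"
  "f \<oplus>\<^bsub>left_dual T M\<^esub> g = (\<lambda>m\<in>carrier M. f m \<oplus>\<^bsub>T\<^esub> g m)"
  "r \<odot>\<^bsub>left_dual T M\<^esub> f = (\<lambda>m\<in>carrier M. f (m \<odot>\<^sub>r\<^bsub>M\<^esub> r))"
  "f \<odot>\<^sub>r\<^bsub>left_dual T M\<^esub> t = (\<lambda>m\<in>carrier M. f m \<otimes>\<^bsub>T\<^esub> t)"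
  by (simp_all add: left_dual_def)

lemma mem_left_dual_iff:
  "f \<in> carrier (left_dual T M) \<longleftrightarrow> f \<in> extensional (carrier M) \<and>
    (\<forall>x\<in>carrier M. f x \<in> carrier T) \<and>
    (\<forall>x\<in>carrier M. \<forall>y\<in>carrier M. f (x \<oplus>\<^bsub>M\<^esub> y) = f x \<oplus>\<^bsub>T\<^esub> f y) \<and>
    (\<forall>t\<in>carrier T. \<forall>x\<in>carrier M. f (t \<odot>\<^bsub>M\<^esub> x) = t \<otimes>\<^bsub>T\<^esub> f x)"
  by (auto simp: left_dual_def PiE_def)

text \<open>Functionals are extensional, so each law may be checked pointwise on \<open>M\<close>,
  where it follows from laws of \<open>T\<close> and of the right action on \<open>M\<close>.
  Precomposing with that right action gives a left action: \<open>m (r s) = (m r) s\<close> yields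
  \<open>(r s) f = r (s f)\<close>.\<close>

lemma bimodule_left_dual:
  assumes "bimodule T R M"
  shows "bimodule R T (left_dual T M)"
proof -
  interpret bimodule T R M by fact
  let ?D = "left_dual T M"
  have eqI: "f = g"
    if "f \<in> carrier ?D" "g \<in> carrier ?D" "\<And>x. x \<in> carrier M \<Longrightarrow> f x = g x" for f g
    using that by (auto simp: mem_left_dual_iff intro: extensionalityI)
  have neg_closed: "f \<in> carrier ?D \<Longrightarrow> (\<lambda>m\<in>carrier M. \<ominus>\<^bsub>T\<^esub> f m) \<in> carrier ?D" for f
    by (simp add: mem_left_dual_iff L.minus_add L.r_minus L.a_comm)
  have closed: "\<zero>\<^bsub>?D\<^esub> \<in> carrier ?D"
    "\<lbrakk>f \<in> carrier ?D; g \<in> carrier ?D\<rbrakk> \<Longrightarrow> f \<oplus>\<^bsub>?D\<^esub> g \<in> carrier ?D"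
    "\<lbrakk>f \<in> carrier ?D; r \<in> carrier R\<rbrakk> \<Longrightarrow> r \<odot>\<^bsub>?D\<^esub> f \<in> carrier ?D"
    "\<lbrakk>f \<in> carrier ?D; t \<in> carrier T\<rbrakk> \<Longrightarrow> f \<odot>\<^sub>r\<^bsub>?D\<^esub> t \<in> carrier ?D" for f g r t
    by (simp_all add: left_dual_simps mem_left_dual_iff L.a_ac L.r_distr L.l_distr L.m_assoc
        rsmult_l_distr smult_commute)
  have app: "\<zero>\<^bsub>?D\<^esub> x = \<zero>\<^bsub>T\<^esub>" "(f \<oplus>\<^bsub>?D\<^esub> g) x = f x \<oplus>\<^bsub>T\<^esub> g x"
    "(r \<odot>\<^bsub>?D\<^esub> f) x = f (x \<odot>\<^sub>r\<^bsub>M\<^esub> r)" "(f \<odot>\<^sub>r\<^bsub>?D\<^esub> t) x = f x \<otimes>\<^bsub>T\<^esub> t"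
    if "x \<in> carrier M" for f g r t x
    using that by (simp_all add: left_dual_simps)
  have val: "f x \<in> carrier T" if "f \<in> carrier ?D" "x \<in> carrier M" for f x
    using that by (simp add: mem_left_dual_iff)
  have add: "f (x \<oplus>\<^bsub>M\<^esub> y) = f x \<oplus>\<^bsub>T\<^esub> f y"
    if "f \<in> carrier ?D" "x \<in> carrier M" "y \<in> carrier M" for f x y
    using that by (simp add: mem_left_dual_iff)
  have "abelian_group ?D"
  proof (rule abelian_groupI)
    fix f assume f: "f \<in> carrier ?D"
    then have "(\<lambda>m\<in>carrier M. \<ominus>\<^bsub>T\<^esub> f m) \<oplus>\<^bsub>?D\<^esub> f = \<zero>\<^bsub>?D\<^esub>"
      by (intro eqI) (simp_all add: closed neg_closed app L.l_neg val)
    then show "\<exists>g\<in>carrier ?D. g \<oplus>\<^bsub>?D\<^esub> f = \<zero>\<^bsub>?D\<^esub>"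
      using neg_closed[OF f] by blast
  qed (simp_all add: closed, (rule eqI; simp add: closed app val L.a_ac)+)
  then show ?thesis
    by (intro bimodule.intro bimodule_axioms.intro R.ring_axioms L.ring_axioms)
      (simp_all add: closed, (rule eqI; simp add: closed app val add L.r_distr L.l_distr
        L.m_assoc rsmult_r_distr rsmult_assoc rsmult_one)+)
qed

text \<open>The pairing of \<open>m\<close> and \<open>f\<close> to \<open>f m\<close> is balanced
  by the very definition of the action of \<open>R\<close> on the dual, so the universal property
  applies.\<close>

lemma evaluation_map_hom:
  assumes "bimodule T R M"
  shows "evaluation_map T \<in> bimodule_hom T T (tensor M R (left_dual T M)) (regular_bimodule T)"
    and "\<lbrakk>m \<in> carrier M; f \<in> carrier (left_dual T M)\<rbrakk> \<Longrightarrow>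
      evaluation_map T (tensor_elem M R (left_dual T M) m f) = f m"
proof -
  interpret M: bimodule T R M by fact
  interpret W: tensor_product T R T M "left_dual T M"
    by (intro tensor_product.intro assms bimodule_left_dual)
  note regular = M.L.bimodule_regular
  \<comment> \<open>The lift uses only the additive structure of its target, which \<open>T\<close>
    and \<open>regular_bimodule T\<close> share. The change of target lets
    \<open>tensor_lift_hom\<close> apply, as it expects a bimodule.\<close>
  have lift: "evaluation_map T = tensor_lift (regular_bimodule T) (\<lambda>m f. f m)"
    by (rule ext) (simp add: evaluation_map_def tensor_lift_def frag_eval_def finsum_def add_pow_def
        regular_bimodule_def finprod_def int_pow_def nat_pow_def m_inv_def Let_def cong: if_cong)
  show "evaluation_map T \<in> bimodule_hom T T (tensor M R (left_dual T M)) (regular_bimodule T)"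
    unfolding lift
    by (rule W.tensor_lift_hom[OF regular]) (simp_all add: mem_left_dual_iff left_dual_simps)
  show "evaluation_map T (tensor_elem M R (left_dual T M) m f) = f m"
    if "m \<in> carrier M" "f \<in> carrier (left_dual T M)"
    unfolding lift
    by (rule W.tensor_lift_elem[OF bimodule.axioms(3)[OF regular]])
      (use that in \<open>simp_all add: mem_left_dual_iff left_dual_simps\<close>)
qed

lemma separable_if_split_epi:
  assumes M: "bimodule T R M" and X: "bimodule R T X"
    and "split_epi T T (tensor M R X) (regular_bimodule T) \<phi>"
  shows "separable_bimodule T R M"
proof -
  let ?D = "left_dual T M"
  let ?WX = "tensor M R X"
  let ?WD = "tensor M R ?D"
  let ?u = "evaluation_map T"
  interpret M: bimodule T R M by fact
  interpret X: bimodule R T X by fact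
  interpret WX: tensor_product T R T M X by (intro tensor_product.intro M X)
  interpret WD: tensor_product T R T M ?D by (intro tensor_product.intro M bimodule_left_dual)
  obtain g where \<phi>: "\<phi> \<in> bimodule_hom T T ?WX (regular_bimodule T)"
    and g: "g \<in> bimodule_hom T T (regular_bimodule T) ?WX"
    and \<phi>g: "\<And>t. t \<in> carrier T \<Longrightarrow> \<phi> (g t) = t"
    using assms(3) by (auto simp: split_epi_def)
  have \<phi>_hom: "C \<in> carrier ?WX \<Longrightarrow> \<phi> C \<in> carrier T"
    "\<lbrakk>C \<in> carrier ?WX; C' \<in> carrier ?WX\<rbrakk> \<Longrightarrow> \<phi> (C \<oplus>\<^bsub>?WX\<^esub> C') = \<phi> C \<oplus>\<^bsub>T\<^esub> \<phi> C'"
    "\<lbrakk>t \<in> carrier T; C \<in> carrier ?WX\<rbrakk> \<Longrightarrow> \<phi> (t \<odot>\<^bsub>?WX\<^esub> C) = t \<otimes>\<^bsub>T\<^esub> \<phi> C"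
    "\<lbrakk>t \<in> carrier T; C \<in> carrier ?WX\<rbrakk> \<Longrightarrow> \<phi> (C \<odot>\<^sub>r\<^bsub>?WX\<^esub> t) = \<phi> C \<otimes>\<^bsub>T\<^esub> t" for C C' t
    using \<phi> by (auto simp: bimodule_hom_def)
  \<comment> \<open>The restriction to \<open>carrier M\<close> makes \<open>d x\<close>
    extensional, as membership in the dual demands.\<close>
  define d where "d x = (\<lambda>m\<in>carrier M. \<phi> (tensor_elem M R X m x))" for x
  have d_closed: "d x \<in> carrier ?D" if "x \<in> carrier X" for x
    using that by (simp add: d_def mem_left_dual_iff \<phi>_hom WX.tensor_elem_add_left
        flip: WX.lsmult_tensor_elem)
  have d_add: "d (x \<oplus>\<^bsub>X\<^esub> x') = d x \<oplus>\<^bsub>?D\<^esub> d x'" if "x \<in> carrier X" "x' \<in> carrier X" for x x'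
    using that by (auto simp: d_def left_dual_simps \<phi>_hom WX.tensor_elem_add_right)
  have d_left: "d (r \<odot>\<^bsub>X\<^esub> x) = r \<odot>\<^bsub>?D\<^esub> d x" if "r \<in> carrier R" "x \<in> carrier X" for r x
    using that by (auto simp: d_def left_dual_simps WX.tensor_elem_balanced)
  have d_right: "d (x \<odot>\<^sub>r\<^bsub>X\<^esub> t) = d x \<odot>\<^sub>r\<^bsub>?D\<^esub> t" if "t \<in> carrier T" "x \<in> carrier X" for t x
    using that by (auto simp: d_def left_dual_simps \<phi>_hom simp flip: WX.rsmult_tensor_elem)
  \<comment> \<open>The lift \<open>h\<close> of this pairing is the map induced by \<open>d\<close>
    on the second tensor factor.\<close>
  define b where "b m x = tensor_elem M R ?D m (d x)" for m x
  define h where "h = tensor_lift ?WD b"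
  have b: "\<lbrakk>m \<in> carrier M; x \<in> carrier X\<rbrakk> \<Longrightarrow> b m x \<in> carrier ?WD"
    "\<lbrakk>m \<in> carrier M; m' \<in> carrier M; x \<in> carrier X\<rbrakk> \<Longrightarrow> b (m \<oplus>\<^bsub>M\<^esub> m') x = b m x \<oplus>\<^bsub>?WD\<^esub> b m' x"
    "\<lbrakk>m \<in> carrier M; x \<in> carrier X; x' \<in> carrier X\<rbrakk> \<Longrightarrow> b m (x \<oplus>\<^bsub>X\<^esub> x') = b m x \<oplus>\<^bsub>?WD\<^esub> b m x'"
    "\<lbrakk>m \<in> carrier M; r \<in> carrier R; x \<in> carrier X\<rbrakk> \<Longrightarrow> b (m \<odot>\<^sub>r\<^bsub>M\<^esub> r) x = b m (r \<odot>\<^bsub>X\<^esub> x)"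
    "\<lbrakk>t \<in> carrier T; m \<in> carrier M; x \<in> carrier X\<rbrakk> \<Longrightarrow> b (t \<odot>\<^bsub>M\<^esub> m) x = t \<odot>\<^bsub>?WD\<^esub> b m x"
    "\<lbrakk>m \<in> carrier M; x \<in> carrier X; t \<in> carrier T\<rbrakk> \<Longrightarrow> b m (x \<odot>\<^sub>r\<^bsub>X\<^esub> t) = b m x \<odot>\<^sub>r\<^bsub>?WD\<^esub> t"
    for m m' x x' r t
    unfolding b_def
    by (simp_all only: d_closed d_add d_left d_right WD.tensor_elem_closed WD.tensor_elem_add_left
        WD.tensor_elem_add_right WD.tensor_elem_balanced WD.lsmult_tensor_elem
        WD.rsmult_tensor_elem)
  have h: "h \<in> bimodule_hom T T ?WX ?WD"
    unfolding h_def by (rule WX.tensor_lift_hom[OF WD.bimodule_tensor b])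
  have "h (tensor_elem M R X m x) = b m x" if "m \<in> carrier M" "x \<in> carrier X" for m x
    unfolding h_def by (rule WX.tensor_lift_elem[OF WD.abelian_group_tensor b(1-4) that])
  then have h_elem: "h (tensor_elem M R X m x) = tensor_elem M R ?D m (d x)"
    if "m \<in> carrier M" "x \<in> carrier X" for m x
    using that by (simp only: b_def)
  note u = evaluation_map_hom[OF M]
  have uh: "?u \<circ> h \<in> bimodule_hom T T ?WX (regular_bimodule T)"
    by (rule bimodule_hom_compose[OF h u(1)])
  have "(?u \<circ> h) (tensor_elem M R X m x) = \<phi> (tensor_elem M R X m x)"
    if "m \<in> carrier M" "x \<in> carrier X" for m x
    using that by (simp add: h_elem u(2) d_closed) (simp add: d_def)
  \<comment> \<open>Both maps are additive and agree on pure tensors.\<close>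
  then have factor: "(?u \<circ> h) C = \<phi> C" if "C \<in> carrier ?WX" for C
    by (intro WX.tensor_hom_eqI[where f = "?u \<circ> h" and g = \<phi>,
          OF bimodule.axioms(3)[OF M.L.bimodule_regular] _ _ _ _ _ that])
      (use \<phi> uh in \<open>auto simp: bimodule_hom_def\<close>)
  have "h \<circ> g \<in> bimodule_hom T T (regular_bimodule T) ?WD"
    by (rule bimodule_hom_compose[OF g h])
  moreover have "?u ((h \<circ> g) t) = t" if "t \<in> carrier T" for t
    using factor[of "g t"] \<phi>g[OF that] g that by (auto simp: bimodule_hom_def)
  ultimately show ?thesis
    unfolding separable_bimodule_def split_epi_def
    using u(1) by (intro conjI bexI[of _ "h \<circ> g"]) simp_all
qed

theorem theorem3p5:
  fixes T :: "('t, 'c) ring_scheme" and R :: "('r, 'd) ring_scheme"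
    and M :: "('t, 'm, 'r, 'e) bimodule_scheme"
  assumes "ring R" and "ring T" and "bimodule T R M"
  shows
    "(separable_bimodule T R M \<longleftrightarrow>
       (\<exists>\<phi>. split_epi T T (tensor M R (left_dual T M)) (regular_bimodule T) \<phi>)) \<and>
     (separable_bimodule T R M \<longleftrightarrow>
       (\<exists>X :: ('r, 'm \<Rightarrow> 't, 't) bimodule. \<exists>\<phi>. bimodule R T X \<and>
          split_epi T T (tensor M R X) (regular_bimodule T) \<phi>)) \<and>
     ((\<exists>X :: ('r, 'x, 't) bimodule. \<exists>\<phi>. bimodule R T X \<and>
          split_epi T T (tensor M R X) (regular_bimodule T) \<phi>) \<longrightarrow>
       separable_bimodule T R M) \<and>
     (separable_bimodule T R M \<longleftrightarrow>
       (\<exists>A. direct_summand T T A (tensor M R (left_dual T M)) \<and>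
          bimodule_iso T T (regular_bimodule T)
            ((tensor M R (left_dual T M))\<lparr>carrier := A\<rparr>)))"
proof -
  let ?D = "left_dual T M"
  let ?Q = "regular_bimodule T"
  note dual = bimodule_left_dual[OF assms(3)]
  have W: "bimodule T T (tensor M R ?D)"
    by (intro tensor_product.bimodule_tensor tensor_product.intro assms(3) dual)
  note regular = ring.bimodule_regular[OF assms(2)]
  note sep = separable_if_split_epi[OF assms(3)]
  have dual_epi: "separable_bimodule T R M \<longleftrightarrow> (\<exists>\<phi>. split_epi T T (tensor M R ?D) ?Q \<phi>)"
    using sep[OF dual] unfolding separable_bimodule_def by blast
  \<comment> \<open>The element type of \<open>X\<close> is left arbitrary, so that the fact can be
    used both for the type of the dual and for the type \<open>'x\<close> of the theorem.\<close>
  have sep_if: "separable_bimodule T R M"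
    if "\<exists>X :: ('r, 'y, 't) bimodule. \<exists>\<phi>. bimodule R T X \<and> split_epi T T (tensor M R X) ?Q \<phi>"
    using that by (elim exE conjE) (rule sep)
  \<comment> \<open>The witness is the left dual, which dictates the element type of
    \<open>X\<close> here.\<close>
  have if_sep: "\<exists>X :: ('r, 'm \<Rightarrow> 't, 't) bimodule. \<exists>\<phi>. bimodule R T X \<and>
      split_epi T T (tensor M R X) ?Q \<phi>" if "separable_bimodule T R M"
    using that dual unfolding dual_epi by (intro exI[of _ ?D]) simp
  have summand: "separable_bimodule T R M \<longleftrightarrow>
      (\<exists>A. direct_summand T T A (tensor M R ?D) \<and>
        bimodule_iso T T ?Q ((tensor M R ?D)\<lparr>carrier := A\<rparr>))"
    unfolding dual_epi
    using split_epi_imp_direct_summand[OF W regular] direct_summand_imp_split_epi[OF W regular]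
    by blast
  show ?thesis
    by (intro conjI, rule dual_epi, rule iffI, erule if_sep, erule sep_if, rule impI,
        erule sep_if, rule summand)
qed

end
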